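(* Let $\mathfrak{N}_1^{\mathbb{C}}$ be the $3$-dimensional complex Zinbiel algebra with basis $e_1,e_2,e_3$ and multiplication $e_1e_1=e_2$ (all other products of basis elements are zero). Let $[\mathfrak{N}_1^{\mathbb{C}}]^i$ be an $i$-dimensional non-trivial central extension of $\mathfrak{N}_1^{\mathbb{C}}$. Then $[\mathfrak{N}_1^{\mathbb{C}}]^i$ is isomorphic to one algebra from the following list, where each algebra has basis $e_1,\dots,e_{3+i}$, only the nonzero products of basis elements are written, and $\alpha\in\mathbb{C}$ is an arbitrary parameter. (1) If $i=1$: - $[\mathfrak{N}_1^{\mathbb{C}}]^1_{01}$: $e_1e_1=e_2,\ e_1e_2=e_4,\ e_2e_1=2e_4,\ e_3e_3=e_4$; - $[\mathfrak{N}_1^{\mathbb{C}}]^1_{02}$: $e_1e_1=e_2,\ e_1e_2=e_4,\ e_1e_3=e_4,\ e_2e_1=2e_4$. (2) If $i=2$: - $[\mathfrak{N}_1^{\mathbb{C}}]^2_{01}$: $e_1e_1=e_2,\ e_1e_2=e_4,\ e_1e_3=e_5,\ e_2e_1=2e_4$; - $[\mathfrak{N}_1^{\mathbb{C}}]^2_{02}(\alpha)$: $e_1e_1=e_2,\ e_1e_2=e_4,\ e_1e_3=\alpha e_5,\ e_2e_1=2e_4,\ e_3e_1=e_5$; - $[\mathfrak{N}_1^{\mathbb{C}}]^2_{03}$: $e_1e_1=e_2,\ e_1e_2=e_4,\ e_1e_3=e_5,\ e_2e_1=2e_4,\ e_3e_3=e_5$; - $[\mathfrak{N}_1^{\mathbb{C}}]^2_{04}$: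 $e_1e_1=e_2,\ e_1e_2=e_4,\ e_2e_1=2e_4,\ e_3e_3=e_5$; - $[\mathfrak{N}_1^{\mathbb{C}}]^2_{05}$: $e_1e_1=e_2,\ e_1e_2=e_4,\ e_1e_3=e_4,\ e_2e_1=2e_4,\ e_3e_3=e_5$; - $[\mathfrak{N}_1^{\mathbb{C}}]^2_{06}$: $e_1e_1=e_2,\ e_1e_2=e_4,\ e_1e_3=e_4+e_5,\ e_2e_1=2e_4,\ e_3e_3=e_5$; - $[\mathfrak{N}_1^{\mathbb{C}}]^2_{07}$: $e_1e_1=e_2,\ e_1e_2=e_4,\ e_1e_3=e_5,\ e_2e_1=2e_4,\ e_3e_1=e_4+2e_5$; - $[\mathfrak{N}_1^{\mathbb{C}}]^2_{08}$: $e_1e_1=e_2,\ e_1e_2=e_4,\ e_1e_3=e_5,\ e_2e_1=2e_4,\ e_3e_3=e_4$; - $[\mathfrak{N}_1^{\mathbb{C}}]^2_{09}(\alpha)$: $e_1e_1=e_2,\ e_1e_2=e_4,\ e_1e_3=\alpha e_5,\ e_2e_1=2e_4,\ e_3e_1=e_5,\ e_3e_3=e_4$. (3) If $i=3$: - $[\mathfrak{N}_1^{\mathbb{C}}]^3_{01}$: $e_1e_1=e_2,\ e_1e_2=e_4,\ e_1e_3=e_5,\ e_2e_1=2e_4,\ e_3e_1=e_6$; - $[\mathfrak{N}_1^{\mathbb{C}}]^3_{02}$: $e_1e_1=e_2,\ e_1e_2=e_4,\ e_1e_3=e_5,\ e_2e_1=2e_4,\ e_3e_3=e_6$; - $[\mathfrak{N}_1^{\mathbb{C}}]^3_{03}(\alpha)$: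 $e_1e_1=e_2,\ e_1e_2=e_4,\ e_1e_3=\alpha e_5,\ e_2e_1=2e_4,\ e_3e_1=e_5,\ e_3e_3=e_6$; - $[\mathfrak{N}_1^{\mathbb{C}}]^3_{04}$: $e_1e_1=e_2,\ e_1e_2=e_4,\ e_1e_3=e_5,\ e_2e_1=2e_4,\ e_3e_1=e_5+e_6,\ e_3e_3=e_6$; - $[\mathfrak{N}_1^{\mathbb{C}}]^3_{05}$: $e_1e_1=e_2,\ e_1e_2=e_4,\ e_1e_3=e_5,\ e_2e_1=2e_4,\ e_3e_1=e_4+2e_5,\ e_3e_3=e_6$; - $[\mathfrak{N}_1^{\mathbb{C}}]^3_{06}$: $e_1e_1=e_2,\ e_1e_2=e_4,\ e_1e_3=e_5,\ e_2e_1=2e_4,\ e_3e_1=e_6,\ e_3e_3=e_4$. (4) If $i=4$: - $[\mathfrak{N}_1^{\mathbb{C}}]^4_{01}$: $e_1e_1=e_2,\ e_1e_2=e_4,\ e_1e_3=e_5,\ e_2e_1=2e_4,\ e_3e_1=e_6,\ e_3e_3=e_7$.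
   Context: All algebras and vector spaces are over $\mathbb{C}$ and finite-dimensional. A Zinbiel algebra is a (not necessarily associative) algebra satisfying $(xy)z=x(yz+zy)$. The annihilator of an algebra $\mathbf{A}$ is $\mathrm{Ann}(\mathbf{A})=\{x\in\mathbf{A}: x\mathbf{A}+\mathbf{A}x=0\}$. For a Zinbiel algebra $\mathbf{A}$ and a vector space $\mathbb{V}$, $\mathrm{Z}^2(\mathbf{A},\mathbb{V})$ is the space of bilinear maps $\theta:\mathbf{A}\times\mathbf{A}\to\mathbb{V}$ with $\theta(xy,z)=\theta(x,yz+zy)$ for all $x,y,z\in\mathbf{A}$ (cocycles). For $\theta\in\mathrm{Z}^2(\mathbf{A},\mathbb{V})$, the algebra $\mathbf{A}_\theta=\mathbf{A}\oplus\mathbb{V}$ with product $[x+x',y+y']=xy+\theta(x,y)$ ($x,y\in\mathbf{A}$, $x',y'\in\mathbb{V}$) is a Zinbiel algebra, called a ($\dim\mathbb{V}$)-dimensional central extension of $\mathbf{A}$ by $\mathbb{V}$. A nonzero subspace $I\subseteq\mathrm{Ann}(\mathbf{B})$ is an annihilator component of an algebra $\mathbf{B}$ if $\mathbf{B}=\mathbf{B}_0\oplus I$ as a direct sum of algebras (ideals). A central extension without annihilator component is called non-split. An $i$-dimensional central extension ($i\ge 1$) of a $3$-dimensional algebra $\mathbf{A}$ is called non-trivial if it is non-split and cannot be considered as a central extension of an algebra of dimension smaller than $\dim\mathbf{A}=3$ (equivalently, non-split with annihilator of dimension exactly $i$, i.e. $\mathrm{Ann}(\mathbf{A}_\theta)=\mathbb{V}$).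 *)

theory Defs
  imports Complex_Main "HOL-Library.Function_Algebras" "HOL-Library.Product_Plus"
begin

section \<open>Complex vector spaces\<close>

class complex_vector = ab_group_add +
  fixes scaleC :: "complex \<Rightarrow> 'a \<Rightarrow> 'a"  (infixr "*\<^sub>C" 75)
  assumes scaleC_add_right: "c *\<^sub>C (x + y) = c *\<^sub>C x + c *\<^sub>C y"
    and scaleC_add_left: "(c + d) *\<^sub>C x = c *\<^sub>C x + d *\<^sub>C x"
    and scaleC_scaleC: "c *\<^sub>C d *\<^sub>C x = (c * d) *\<^sub>C x"
    and scaleC_one: "1 *\<^sub>C x = x"

global_interpretation cvs: vector_space "scaleC :: complex \<Rightarrow> 'a \<Rightarrow> 'a::complex_vector"
  by unfold_locales (simp_all add: scaleC_add_right scaleC_add_left scaleC_scaleC scaleC_one)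

instantiation complex :: complex_vector
begin
definition scaleC_complex :: "complex \<Rightarrow> complex \<Rightarrow> complex" where
  "scaleC_complex c x = c * x"
instance
  by standard (simp_all add: scaleC_complex_def algebra_simps)
end

instantiation "fun" :: (type, complex_vector) complex_vector
begin
definition scaleC_fun :: "complex \<Rightarrow> ('a \<Rightarrow> 'b) \<Rightarrow> 'a \<Rightarrow> 'b" where
  "scaleC_fun c f = (\<lambda>x. c *\<^sub>C f x)"
instance
  by standard
    (simp_all add: scaleC_fun_def fun_eq_iff scaleC_add_right scaleC_add_left scaleC_scaleC scaleC_one)
end

instantiation prod :: (complex_vector, complex_vector) complex_vector
begin
definition scaleC_prod :: "complex \<Rightarrow> 'a \<times> 'b \<Rightarrow> 'a \<times> 'b" where
  "scaleC_prod c p = (c *\<^sub>C fst p, c *\<^sub>C snd p)"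
instance
  by standard
    (simp_all add: scaleC_prod_def prod_eq_iff scaleC_add_right scaleC_add_left scaleC_scaleC scaleC_one)
end

text \<open>Vector spaces of varying dimension are subspaces of ambient types.\<close>

definition fd_space :: "'a::complex_vector set \<Rightarrow> bool" where
  "fd_space V \<longleftrightarrow> (\<exists>B. finite B \<and> V = cvs.span B)"

definition linear_on :: "'a::complex_vector set \<Rightarrow> ('a \<Rightarrow> 'b::complex_vector) \<Rightarrow> bool" where
  "linear_on V f \<longleftrightarrow>
     (\<forall>x\<in>V. \<forall>y\<in>V. f (x + y) = f x + f y) \<and> (\<forall>c. \<forall>x\<in>V. f (c *\<^sub>C x) = c *\<^sub>C f x)"

definition bilinear_on ::
  "'a::complex_vector set \<Rightarrow> 'b::complex_vector set \<Rightarrow> ('a \<Rightarrow> 'a \<Rightarrow> 'b) \<Rightarrow> bool" where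
  "bilinear_on U V f \<longleftrightarrow>
     (\<forall>x\<in>U. \<forall>y\<in>U. f x y \<in> V) \<and>
     (\<forall>x\<in>U. linear_on U (f x)) \<and> (\<forall>y\<in>U. linear_on U (\<lambda>x. f x y))"


section \<open>Zinbiel algebras and their central extensions\<close>

record 'a alg =
  carr :: "'a set"
  mul :: "'a \<Rightarrow> 'a \<Rightarrow> 'a"

definition algebra :: "'a::complex_vector alg \<Rightarrow> bool" where
  "algebra A \<longleftrightarrow> fd_space (carr A) \<and> bilinear_on (carr A) (carr A) (mul A)"

definition alg_dim :: "'a::complex_vector alg \<Rightarrow> nat" where
  "alg_dim A = cvs.dim (carr A)"

definition zinbiel :: "'a::complex_vector alg \<Rightarrow> bool" where
  "zinbiel A \<longleftrightarrow> algebra A \<and>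
     (\<forall>x\<in>carr A. \<forall>y\<in>carr A. \<forall>z\<in>carr A.
        mul A (mul A x y) z = mul A x (mul A y z + mul A z y))"

definition alg_iso :: "'a::complex_vector alg \<Rightarrow> 'b::complex_vector alg \<Rightarrow> bool"
    (infix "\<cong>\<^sub>a" 50) where
  "A \<cong>\<^sub>a B \<longleftrightarrow> (\<exists>f. bij_betw f (carr A) (carr B) \<and> linear_on (carr A) f \<and>
     (\<forall>x\<in>carr A. \<forall>y\<in>carr A. f (mul A x y) = mul B (f x) (f y)))"

definition Ann :: "'a::complex_vector alg \<Rightarrow> 'a set" where
  "Ann A = {x \<in> carr A. \<forall>y\<in>carr A. mul A x y = 0 \<and> mul A y x = 0}"

definition ideal :: "'a::complex_vector alg \<Rightarrow> 'a set \<Rightarrow> bool" where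
  "ideal A I \<longleftrightarrow> cvs.subspace I \<and> I \<subseteq> carr A \<and>
     (\<forall>x\<in>I. \<forall>y\<in>carr A. mul A x y \<in> I \<and> mul A y x \<in> I)"

definition annihilator_component :: "'a::complex_vector alg \<Rightarrow> 'a set \<Rightarrow> bool" where
  "annihilator_component B I \<longleftrightarrow>
     cvs.subspace I \<and> I \<noteq> {0} \<and> I \<subseteq> Ann B \<and>
     (\<exists>B\<^sub>0. ideal B B\<^sub>0 \<and> ideal B I \<and> B\<^sub>0 \<inter> I = {0} \<and> carr B = {x + y | x y. x \<in> B\<^sub>0 \<and> y \<in> I})"

definition non_split :: "'a::complex_vector alg \<Rightarrow> bool" where
  "non_split B \<longleftrightarrow> (\<nexists>I. annihilator_component B I)"

definition Z2 ::
  "'a::complex_vector alg \<Rightarrow> 'b::complex_vector set \<Rightarrow> ('a \<Rightarrow> 'a \<Rightarrow> 'b) set" where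
  "Z2 A V = {\<theta>. bilinear_on (carr A) V \<theta> \<and>
     (\<forall>x\<in>carr A. \<forall>y\<in>carr A. \<forall>z\<in>carr A. \<theta> (mul A x y) z = \<theta> x (mul A y z + mul A z y))}"

definition central_ext ::
  "'a::complex_vector alg \<Rightarrow> 'b::complex_vector set \<Rightarrow> ('a \<Rightarrow> 'a \<Rightarrow> 'b) \<Rightarrow> ('a \<times> 'b) alg" where
  "central_ext A V \<theta> =
     \<lparr>carr = carr A \<times> V, mul = (\<lambda>p q. (mul A (fst p) (fst q), \<theta> (fst p) (fst q)))\<rparr>"

text \<open>In the second condition the algebra and the vector space may be arbitrary; it is enough to
  let them range over subspaces of one infinite-dimensional space, since every finite-dimensional
  complex vector space is isomorphic to such a subspace.\<close>

definition nontrivial_ext ::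
  "'a::complex_vector alg \<Rightarrow> 'b::complex_vector set \<Rightarrow> ('a \<Rightarrow> 'a \<Rightarrow> 'b) \<Rightarrow> bool" where
  "nontrivial_ext A V \<theta> \<longleftrightarrow>
     non_split (central_ext A V \<theta>) \<and>
     \<not> (\<exists>(C :: (nat \<Rightarrow> complex) alg) (W :: (nat \<Rightarrow> complex) set) \<eta>.
          zinbiel C \<and> alg_dim C < alg_dim A \<and> fd_space W \<and> \<eta> \<in> Z2 C W \<and>
          central_ext A V \<theta> \<cong>\<^sub>a central_ext C W \<eta>)"


section \<open>Algebras given by a multiplication table\<close>

definition e :: "nat \<Rightarrow> nat \<Rightarrow> complex" where
  "e k = (\<lambda>j. if j = k then 1 else 0)"

definition table_entry :: "((nat \<times> nat) \<times> (nat \<Rightarrow> complex)) list \<Rightarrow> nat \<Rightarrow> nat \<Rightarrow> nat \<Rightarrow> complex"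
  where "table_entry T i j = (case map_of T (i, j) of None \<Rightarrow> 0 | Some v \<Rightarrow> v)"

text \<open>The algebra with basis \<open>e 1, \<dots>, e n\<close>, realised on the functions supported
  in \<open>{1..n}\<close>; products of basis elements missing from the table are zero.\<close>

definition table_alg :: "nat \<Rightarrow> ((nat \<times> nat) \<times> (nat \<Rightarrow> complex)) list \<Rightarrow> (nat \<Rightarrow> complex) alg" where
  "table_alg n T =
     \<lparr>carr = {x. \<forall>k. k \<notin> {1..n} \<longrightarrow> x k = 0},
      mul = (\<lambda>x y. \<Sum>i=1..n. \<Sum>j=1..n. (x i * y j) *\<^sub>C table_entry T i j)\<rparr>"

lemma mul_table_alg_basis:
  assumes "i \<in> {1..n}" "j \<in> {1..n}"
  shows "mul (table_alg n T) (e i) (e j) = table_entry T i j"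
proof -
  have "(\<Sum>j'=1..n. (e i i' * e j j') *\<^sub>C table_entry T i' j') = e i i' *\<^sub>C table_entry T i' j" for i'
  proof -
    have "(\<Sum>j'=1..n. (e i i' * e j j') *\<^sub>C table_entry T i' j')
        = (\<Sum>j'=1..n. if j' = j then e i i' *\<^sub>C table_entry T i' j else 0)"
      by (rule sum.cong) (auto simp: e_def)
    then show ?thesis using assms by simp
  qed
  then have "mul (table_alg n T) (e i) (e j) = (\<Sum>i'=1..n. e i i' *\<^sub>C table_entry T i' j)"
    by (simp add: table_alg_def)
  also have "\<dots> = (\<Sum>i'=1..n. if i' = i then table_entry T i j else 0)"
    by (rule sum.cong) (auto simp: e_def)
  finally show ?thesis using assms by simp
qed

definition N1 :: "(nat \<Rightarrow> complex) alg" where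
  "N1 = table_alg 3 [((1,1), e 2)]"

definition N1_1_01 :: "(nat \<Rightarrow> complex) alg" where
  "N1_1_01 = table_alg 4
     [((1,1), e 2), ((1,2), e 4), ((2,1), 2 *\<^sub>C e 4), ((3,3), e 4)]"

definition N1_1_02 :: "(nat \<Rightarrow> complex) alg" where
  "N1_1_02 = table_alg 4
     [((1,1), e 2), ((1,2), e 4), ((1,3), e 4), ((2,1), 2 *\<^sub>C e 4)]"

definition N1_2_01 :: "(nat \<Rightarrow> complex) alg" where
  "N1_2_01 = table_alg 5
     [((1,1), e 2), ((1,2), e 4), ((1,3), e 5), ((2,1), 2 *\<^sub>C e 4)]"

definition N1_2_02 :: "complex \<Rightarrow> (nat \<Rightarrow> complex) alg" where
  "N1_2_02 \<alpha> = table_alg 5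
     [((1,1), e 2), ((1,2), e 4), ((1,3), \<alpha> *\<^sub>C e 5), ((2,1), 2 *\<^sub>C e 4), ((3,1), e 5)]"

definition N1_2_03 :: "(nat \<Rightarrow> complex) alg" where
  "N1_2_03 = table_alg 5
     [((1,1), e 2), ((1,2), e 4), ((1,3), e 5), ((2,1), 2 *\<^sub>C e 4), ((3,3), e 5)]"

definition N1_2_04 :: "(nat \<Rightarrow> complex) alg" where
  "N1_2_04 = table_alg 5
     [((1,1), e 2), ((1,2), e 4), ((2,1), 2 *\<^sub>C e 4), ((3,3), e 5)]"

definition N1_2_05 :: "(nat \<Rightarrow> complex) alg" where
  "N1_2_05 = table_alg 5
     [((1,1), e 2), ((1,2), e 4), ((1,3), e 4), ((2,1), 2 *\<^sub>C e 4), ((3,3), e 5)]"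

definition N1_2_06 :: "(nat \<Rightarrow> complex) alg" where
  "N1_2_06 = table_alg 5
     [((1,1), e 2), ((1,2), e 4), ((1,3), e 4 + e 5), ((2,1), 2 *\<^sub>C e 4), ((3,3), e 5)]"

definition N1_2_07 :: "(nat \<Rightarrow> complex) alg" where
  "N1_2_07 = table_alg 5
     [((1,1), e 2), ((1,2), e 4), ((1,3), e 5), ((2,1), 2 *\<^sub>C e 4), ((3,1), e 4 + 2 *\<^sub>C e 5)]"

definition N1_2_08 :: "(nat \<Rightarrow> complex) alg" where
  "N1_2_08 = table_alg 5
     [((1,1), e 2), ((1,2), e 4), ((1,3), e 5), ((2,1), 2 *\<^sub>C e 4), ((3,3), e 4)]"

definition N1_2_09 :: "complex \<Rightarrow> (nat \<Rightarrow> complex) alg" where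
  "N1_2_09 \<alpha> = table_alg 5
     [((1,1), e 2), ((1,2), e 4), ((1,3), \<alpha> *\<^sub>C e 5), ((2,1), 2 *\<^sub>C e 4), ((3,1), e 5),
      ((3,3), e 4)]"

definition N1_3_01 :: "(nat \<Rightarrow> complex) alg" where
  "N1_3_01 = table_alg 6
     [((1,1), e 2), ((1,2), e 4), ((1,3), e 5), ((2,1), 2 *\<^sub>C e 4), ((3,1), e 6)]"

definition N1_3_02 :: "(nat \<Rightarrow> complex) alg" where
  "N1_3_02 = table_alg 6
     [((1,1), e 2), ((1,2), e 4), ((1,3), e 5), ((2,1), 2 *\<^sub>C e 4), ((3,3), e 6)]"

definition N1_3_03 :: "complex \<Rightarrow> (nat \<Rightarrow> complex) alg" where
  "N1_3_03 \<alpha> = table_alg 6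
     [((1,1), e 2), ((1,2), e 4), ((1,3), \<alpha> *\<^sub>C e 5), ((2,1), 2 *\<^sub>C e 4), ((3,1), e 5),
      ((3,3), e 6)]"

definition N1_3_04 :: "(nat \<Rightarrow> complex) alg" where
  "N1_3_04 = table_alg 6
     [((1,1), e 2), ((1,2), e 4), ((1,3), e 5), ((2,1), 2 *\<^sub>C e 4), ((3,1), e 5 + e 6),
      ((3,3), e 6)]"

definition N1_3_05 :: "(nat \<Rightarrow> complex) alg" where
  "N1_3_05 = table_alg 6
     [((1,1), e 2), ((1,2), e 4), ((1,3), e 5), ((2,1), 2 *\<^sub>C e 4), ((3,1), e 4 + 2 *\<^sub>C e 5),
      ((3,3), e 6)]"

definition N1_3_06 :: "(nat \<Rightarrow> complex) alg" where
  "N1_3_06 = table_alg 6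
     [((1,1), e 2), ((1,2), e 4), ((1,3), e 5), ((2,1), 2 *\<^sub>C e 4), ((3,1), e 6), ((3,3), e 4)]"

definition N1_4_01 :: "(nat \<Rightarrow> complex) alg" where
  "N1_4_01 = table_alg 7
     [((1,1), e 2), ((1,2), e 4), ((1,3), e 5), ((2,1), 2 *\<^sub>C e 4), ((3,1), e 6), ((3,3), e 7)]"

end

theory Submission
  imports Defs
begin

text \<open>
  The cocycle identity leaves very little freedom: it forces \<open>\<theta>(e\<^sub>2, e\<^sub>1) = 2 \<theta>(e\<^sub>1, e\<^sub>2)\<close> and makes
  \<open>\<theta>\<close> vanish on the other pairs involving \<open>e\<^sub>2\<close>, so that \<open>\<theta>\<close> is given by \<open>\<theta>(e\<^sub>1, e\<^sub>1)\<close> and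
  the four vectors \<open>a = \<theta>(e\<^sub>1, e\<^sub>2)\<close>, \<open>b = \<theta>(e\<^sub>1, e\<^sub>3)\<close>, \<open>c = \<theta>(e\<^sub>3, e\<^sub>1)\<close>, \<open>d = \<theta>(e\<^sub>3, e\<^sub>3)\<close> of \<open>V\<close>
  (\<open>cocycle_expand\<close>). The value \<open>\<theta>(e\<^sub>1, e\<^sub>1)\<close> is a coboundary: it disappears when the square of
  \<open>e\<^sub>1\<close> in the extension is taken as the second basis vector.

  Non-triviality becomes three conditions on these vectors. If they did not span \<open>V\<close>, a
  missing direction would split off as an annihilator component (\<open>non_split_span\<close>), and this
  already gives \<open>dim V \<le> 4\<close>. If \<open>b\<close>, \<open>c\<close>, \<open>d\<close> were all zero, \<open>e\<^sub>3\<close> would split off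
  (\<open>non_split_not_all_zero\<close>). If \<open>a\<close> were zero, \<open>e\<^sub>2\<close> would annihilate the extension, and the
  extension would be one of the two-dimensional zero algebra (\<open>nontrivial_ext_imp_nonzero\<close>).

  Replacing \<open>e\<^sub>1\<close> by \<open>x e\<^sub>1 + u e\<^sub>3\<close> and \<open>e\<^sub>3\<close> by \<open>w e\<^sub>3 + s e\<^sub>2\<close> changes \<open>(a, b, c, d)\<close> into
  \<open>(x\<^sup>3 a, x w b + x s a + u w d, x w c + 2 x s a + u w d, w\<^sup>2 d)\<close>
  (\<open>structure_vectors_change\<close>). As \<open>V\<close> is only needed up to linear isomorphism, what matters is
  the linear relations between the four vectors. They are found by asking in turn whether \<open>d\<close> lies
  in the span of \<open>a\<close>, then \<open>c\<close> in the span of \<open>a, d\<close>, then \<open>b\<close> in the span of \<open>a, c, d\<close>.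
  In a relation \<open>b = \<alpha> c + \<beta> a + \<delta> d\<close>, the parameters \<open>s\<close> and \<open>u\<close> change \<open>\<beta>\<close> by
  \<open>s (1 - 2 \<alpha>)\<close> and \<open>\<delta>\<close> by \<open>u (1 - \<alpha>)\<close>; thus both coefficients can be removed except for
  \<open>\<alpha> = 1/2\<close> and \<open>\<alpha> = 1\<close>, and the remaining scalings \<open>x\<close>, \<open>w\<close> normalise what is left. This is
  the origin of the one-parameter families in the list and of the isolated algebras beside them.
  Each leaf of this case distinction is one algebra of the list, recognised by
  \<open>central_ext_iso_table\<close>.
\<close>

section \<open>Linear and bilinear maps on subspaces\<close>

lemma linear_on_add: "linear_on V f \<Longrightarrow> x \<in> V \<Longrightarrow> y \<in> V \<Longrightarrow> f (x + y) = f x + f y"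
  by (simp add: linear_on_def)

lemma linear_on_scale: "linear_on V f \<Longrightarrow> x \<in> V \<Longrightarrow> f (c *\<^sub>C x) = c *\<^sub>C f x"
  by (simp add: linear_on_def)

lemma linear_on_zero: "linear_on V f \<Longrightarrow> cvs.subspace V \<Longrightarrow> f 0 = 0"
  using linear_on_scale[of V f 0 0] by (simp add: cvs.subspace_0)

lemma linear_on_comb3:
  assumes "linear_on U f" "cvs.subspace U" "x \<in> U" "y \<in> U" "z \<in> U"
  shows "f (\<alpha> *\<^sub>C x + \<beta> *\<^sub>C y + \<gamma> *\<^sub>C z) = \<alpha> *\<^sub>C f x + \<beta> *\<^sub>C f y + \<gamma> *\<^sub>C f z"
  using assms
  by (simp add: linear_on_add[OF assms(1)] linear_on_scale[OF assms(1)] cvs.subspace_add cvs.subspace_scale)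

lemma linear_on_inv_into:
  assumes "bij_betw f A B" "linear_on A f" "cvs.subspace A"
  shows "linear_on B (inv_into A f)"
proof -
  have m: "inv_into A f x \<in> A" "f (inv_into A f x) = x" if "x \<in> B" for x
    using that assms(1) bij_betw_inv_into_right[of f A B x] bij_betwE[OF bij_betw_inv_into[OF assms(1)]] by auto
  have l: "inv_into A f (f a) = a" if "a \<in> A" for a
    using that assms(1) by (simp add: bij_betw_inv_into_left)
  have "inv_into A f (x + y) = inv_into A f x + inv_into A f y" if "x \<in> B" "y \<in> B" for x y
    using l[of "inv_into A f x + inv_into A f y"] that
    by (simp add: m linear_on_add[OF assms(2)] cvs.subspace_add[OF assms(3)])
  moreover have "inv_into A f (c *\<^sub>C x) = c *\<^sub>C inv_into A f x" if "x \<in> B" for c x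
    using l[of "c *\<^sub>C inv_into A f x"] that
    by (simp add: m linear_on_scale[OF assms(2)] cvs.subspace_scale[OF assms(3)])
  ultimately show ?thesis by (simp add: linear_on_def)
qed

lemma alg_iso_sym:
  assumes "A \<cong>\<^sub>a B" "cvs.subspace (carr A)"
    and "\<And>x y. x \<in> carr A \<Longrightarrow> y \<in> carr A \<Longrightarrow> mul A x y \<in> carr A"
  shows "B \<cong>\<^sub>a A"
proof -
  obtain f where f: "bij_betw f (carr A) (carr B)" "linear_on (carr A) f"
    and h: "\<And>x y. x \<in> carr A \<Longrightarrow> y \<in> carr A \<Longrightarrow> f (mul A x y) = mul B (f x) (f y)"
    using assms(1) unfolding alg_iso_def by blast
  let ?g = "inv_into (carr A) f"
  have g: "bij_betw ?g (carr B) (carr A)" by (rule bij_betw_inv_into[OF f(1)])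
  have "?g (mul B x y) = mul A (?g x) (?g y)" if xy: "x \<in> carr B" "y \<in> carr B" for x y
  proof -
    have m: "?g x \<in> carr A" "?g y \<in> carr A" using g xy by (auto dest: bij_betwE)
    have "f (mul A (?g x) (?g y)) = mul B x y"
      using h[OF m] xy f(1) by (simp add: bij_betw_inv_into_right)
    then show ?thesis
      using bij_betw_inv_into_left[OF f(1) assms(3)[OF m]] by simp
  qed
  then show ?thesis
    using g linear_on_inv_into[OF f assms(2)] unfolding alg_iso_def by blast
qed

lemma bilinear_on_comb3:
  assumes "bilinear_on U W f" "cvs.subspace U" "x \<in> U" "y \<in> U" "z \<in> U"
  shows "f (\<alpha> *\<^sub>C x + \<beta> *\<^sub>C y + \<gamma> *\<^sub>C z) (\<alpha>' *\<^sub>C x + \<beta>' *\<^sub>C y + \<gamma>' *\<^sub>C z) =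
     (\<alpha> * \<alpha>') *\<^sub>C f x x + (\<alpha> * \<beta>') *\<^sub>C f x y + (\<alpha> * \<gamma>') *\<^sub>C f x z +
     (\<beta> * \<alpha>') *\<^sub>C f y x + (\<beta> * \<beta>') *\<^sub>C f y y + (\<beta> * \<gamma>') *\<^sub>C f y z +
     (\<gamma> * \<alpha>') *\<^sub>C f z x + (\<gamma> * \<beta>') *\<^sub>C f z y + (\<gamma> * \<gamma>') *\<^sub>C f z z"
proof -
  let ?p = "\<alpha>' *\<^sub>C x + \<beta>' *\<^sub>C y + \<gamma>' *\<^sub>C z"
  have p: "?p \<in> U" using assms by (simp add: cvs.subspace_add cvs.subspace_scale)
  have 1: "linear_on U (f u)" "linear_on U (\<lambda>v. f v u)" if "u \<in> U" for u
    using assms(1) that by (auto simp: bilinear_on_def)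
  show ?thesis
    unfolding linear_on_comb3[OF 1(2)[OF p] assms(2-5)] linear_on_comb3[OF 1(1)[OF assms(3)] assms(2-5)]
      linear_on_comb3[OF 1(1)[OF assms(4)] assms(2-5)] linear_on_comb3[OF 1(1)[OF assms(5)] assms(2-5)]
    by (simp add: scaleC_add_right scaleC_scaleC add.assoc)
qed

section \<open>Functions of finite support and table algebras\<close>

definition supported :: "nat set \<Rightarrow> (nat \<Rightarrow> complex) set" where
  "supported I = {w. \<forall>k. k \<notin> I \<longrightarrow> w k = 0}"

lemma subspace_supported: "cvs.subspace (supported I)"
  by (auto simp: supported_def cvs.subspace_def scaleC_fun_def scaleC_complex_def)

lemma e_in_supported: "e k \<in> supported I \<longleftrightarrow> k \<in> I"
  by (auto simp: supported_def e_def)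

lemma carr_table_alg: "carr (table_alg n T) = supported {1..n}"
  by (simp add: table_alg_def supported_def)

lemma subspace_table_alg: "cvs.subspace (carr (table_alg n T))"
  by (simp add: carr_table_alg subspace_supported)

lemma sum_fun_apply: "(\<Sum>i\<in>S. f i) x = (\<Sum>i\<in>S. f i x)"
  by (induction S rule: infinite_finite_induct) auto

lemma span_e: "cvs.span (e ` {m..n}) = supported {m..n}"
proof
  show "cvs.span (e ` {m..n}) \<subseteq> supported {m..n}"
    by (intro cvs.span_minimal subspace_supported) (auto simp: e_in_supported)
  show "supported {m..n} \<subseteq> cvs.span (e ` {m..n})"
  proof
    fix x assume x: "x \<in> supported {m..n}"
    have "x = (\<Sum>k=m..n. x k *\<^sub>C e k)"
    proof
      fix j
      have "(\<Sum>k=m..n. x k *\<^sub>C e k) j = (\<Sum>k=m..n. if k = j then x j else 0)"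
        unfolding sum_fun_apply
        by (rule sum.cong) (auto simp: scaleC_fun_def scaleC_complex_def e_def)
      then show "x j = (\<Sum>k=m..n. x k *\<^sub>C e k) j" using x by (auto simp: supported_def)
    qed
    also have "\<dots> \<in> cvs.span (e ` {m..n})"
      by (intro cvs.span_sum cvs.span_scale cvs.span_base) auto
    finally show "x \<in> cvs.span (e ` {m..n})" .
  qed
qed

lemma fd_space_supported: "fd_space (supported {m..n})"
  unfolding fd_space_def span_e[symmetric] by blast

lemma alg_dim_table_alg: "alg_dim (table_alg n T) = n"
proof -
  have inj: "inj e" by (auto simp: inj_def e_def fun_eq_iff split: if_splits)
  have "cvs.independent (e ` {1..n})"
  proof
    assume "cvs.dependent (e ` {1..n})"
    then obtain u k where k: "k \<in> {1..n}" "u (e k) \<noteq> 0" and 0: "(\<Sum>v\<in>e ` {1..n}. u v *\<^sub>C v) = 0"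
      by (auto simp: cvs.dependent_finite)
    have "(\<Sum>v\<in>e ` {1..n}. u v *\<^sub>C v) = (\<Sum>j=1..n. u (e j) *\<^sub>C e j)"
      using inj by (subst sum.reindex) (auto intro: inj_on_subset)
    then have "0 = (\<Sum>j=1..n. u (e j) *\<^sub>C e j) k" using 0 by simp
    also have "\<dots> = (\<Sum>j=1..n. if j = k then u (e k) else 0)"
      unfolding sum_fun_apply by (rule sum.cong) (auto simp: scaleC_fun_def scaleC_complex_def e_def)
    also have "\<dots> = u (e k)" using k(1) by simp
    finally show False using k(2) by simp
  qed
  then have "cvs.dim (cvs.span (e ` {1..n})) = card (e ` {1..n})"
    by (rule cvs.dim_span_eq_card_independent)
  also have "\<dots> = n" using inj by (subst card_image) (auto intro: inj_on_subset)
  finally show ?thesis by (simp add: alg_dim_def carr_table_alg span_e)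
qed

section \<open>Adapted bases of the algebra and the shape of its cocycles\<close>

lemma mul_N1: "mul N1 x y = (x 1 * y 1) *\<^sub>C e 2"
  by (simp add: N1_def table_alg_def table_entry_def numeral_3_eq_3)

lemma carr_N1: "carr N1 = supported {1..3}"
  by (simp add: N1_def carr_table_alg)

lemma subspace_N1: "cvs.subspace (carr N1)"
  unfolding N1_def by (rule subspace_table_alg)

lemma e_in_N1: "k \<in> {1..3} \<Longrightarrow> e k \<in> carr N1"
  by (simp add: carr_N1 e_in_supported)

lemma e_apply: "e k j = (if j = k then 1 else 0)" by (simp add: e_def)

lemma mul_N1_in: "mul N1 x y \<in> carr N1"
  by (auto simp: mul_N1 subspace_N1 e_in_N1 cvs.subspace_scale)

lemma bilinear_N1: "bilinear_on (carr N1) (carr N1) (mul N1)"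
  using mul_N1_in
  by (auto simp: bilinear_on_def linear_on_def mul_N1 scaleC_fun_def scaleC_complex_def fun_eq_iff algebra_simps)

text \<open>Pairs that can play the roles of \<open>e\<^sub>1\<close> and \<open>e\<^sub>3\<close>: by the next lemmas \<open>X\<close>, \<open>X X\<close>, \<open>Z\<close> is a basis in
  which the multiplication has the same form, that is, an image of the standard basis under an
  automorphism.\<close>
definition adapted :: "(nat \<Rightarrow> complex) \<Rightarrow> (nat \<Rightarrow> complex) \<Rightarrow> bool" where
  "adapted X Z \<longleftrightarrow> X \<in> carr N1 \<and> Z \<in> carr N1 \<and> X 1 \<noteq> 0 \<and> Z 1 = 0 \<and> Z 3 \<noteq> 0"

lemma adapted_mul:
  assumes "adapted X Z"
  shows "mul N1 X X = (X 1)\<^sup>2 *\<^sub>C e 2" "mul N1 X Z = 0" "mul N1 Z X = 0" "mul N1 Z Z = 0"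
    "mul N1 (mul N1 X X) y = 0" "mul N1 y (mul N1 X X) = 0"
  using assms by (simp_all add: adapted_def mul_N1 power2_eq_square e_def scaleC_fun_def scaleC_complex_def fun_eq_iff)

text \<open>Write \<open>Y = X X\<close>. The cocycle identity for \<open>(X, X, X)\<close> gives \<open>\<theta>(Y, X) = 2 \<theta>(X, Y)\<close>; the
  identities for \<open>(X, X, Y)\<close>, \<open>(X, X, Z)\<close> and \<open>(Z, X, X)\<close>, in which all other products vanish, give
  \<open>\<theta>(Y, Y) = 0\<close>, \<open>\<theta>(Y, Z) = 0\<close> and \<open>2 \<theta>(Z, Y) = 0\<close>.\<close>
lemma cocycle_expand:
  assumes "\<theta> \<in> Z2 N1 V" "adapted X Z"
  shows "\<theta> (\<alpha> *\<^sub>C X + \<beta> *\<^sub>C mul N1 X X + \<gamma> *\<^sub>C Z) (\<alpha>' *\<^sub>C X + \<beta>' *\<^sub>C mul N1 X X + \<gamma>' *\<^sub>C Z) =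
     (\<alpha> * \<alpha>') *\<^sub>C \<theta> X X + (\<alpha> * \<beta>' + 2 * \<beta> * \<alpha>') *\<^sub>C \<theta> X (mul N1 X X) + (\<alpha> * \<gamma>') *\<^sub>C \<theta> X Z +
     (\<gamma> * \<alpha>') *\<^sub>C \<theta> Z X + (\<gamma> * \<gamma>') *\<^sub>C \<theta> Z Z"
proof -
  let ?Y = "mul N1 X X"
  have bil: "bilinear_on (carr N1) V \<theta>"
    and coc: "\<And>x y z. x \<in> carr N1 \<Longrightarrow> y \<in> carr N1 \<Longrightarrow> z \<in> carr N1 \<Longrightarrow>
        \<theta> (mul N1 x y) z = \<theta> x (mul N1 y z + mul N1 z y)"
    using assms(1) by (auto simp: Z2_def)
  have mem: "X \<in> carr N1" "Z \<in> carr N1" "?Y \<in> carr N1"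
    using assms(2) mul_N1_in by (auto simp: adapted_def)
  have r: "linear_on (carr N1) (\<theta> u)" "linear_on (carr N1) (\<lambda>v. \<theta> v u)" if "u \<in> carr N1" for u
    using bil that by (auto simp: bilinear_on_def)
  have z: "\<theta> u 0 = 0" "\<theta> 0 u = 0" if "u \<in> carr N1" for u
    using linear_on_zero[OF r(1)[OF that] subspace_N1] linear_on_zero[OF r(2)[OF that] subspace_N1] by auto
  have two: "\<theta> u (?Y + ?Y) = 2 *\<^sub>C \<theta> u ?Y" if "u \<in> carr N1" for u
    using linear_on_add[OF r(1)[OF that] mem(3) mem(3)] cvs.scale_left_distrib[of 1 1 "\<theta> u ?Y"] by simp
  note m = adapted_mul(2-)[OF assms(2)]
  have YX: "\<theta> ?Y X = 2 *\<^sub>C \<theta> X ?Y" using coc[OF mem(1) mem(1) mem(1)] two[OF mem(1)] by simp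
  have YY: "\<theta> ?Y ?Y = 0" using coc[OF mem(1) mem(1) mem(3)] z[OF mem(1)] by (simp add: m)
  have YZ: "\<theta> ?Y Z = 0" using coc[OF mem(1) mem(1) mem(2)] z[OF mem(1)] by (simp add: m)
  have "2 *\<^sub>C \<theta> Z ?Y = 0"
    using coc[OF mem(2) mem(1) mem(1)] two[OF mem(2)] z(2)[OF mem(1)] by (simp add: m)
  then have ZY: "\<theta> Z ?Y = 0" by simp
  show ?thesis
    by (subst bilinear_on_comb3[OF bil subspace_N1 mem(1,3,2)])
      (simp add: YX YY YZ ZY scaleC_scaleC scaleC_add_left add_ac mult_ac)
qed

lemma adapted_independent:
  assumes "adapted X Z"
  shows "(\<alpha> *\<^sub>C X + \<beta> *\<^sub>C mul N1 X X + \<gamma> *\<^sub>C Z = 0) = (\<alpha> = 0 \<and> \<beta> = 0 \<and> \<gamma> = 0)" (is "?l = ?r")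
proof -
  have c: "(\<alpha> *\<^sub>C X + \<beta> *\<^sub>C mul N1 X X + \<gamma> *\<^sub>C Z) k =
    \<alpha> * X k + (if k = 2 then \<beta> * (X 1)\<^sup>2 else 0) + \<gamma> * Z k" for \<alpha> \<beta> \<gamma> k
    by (simp add: adapted_mul[OF assms(1)] scaleC_fun_def scaleC_complex_def e_def)
  have X: "X 1 \<noteq> 0" "Z 1 = 0" "Z 3 \<noteq> 0" "X \<in> carr N1" "Z \<in> carr N1" using assms by (auto simp: adapted_def)
  show ?thesis
  proof
    assume ?l
    then have "(\<alpha> *\<^sub>C X + \<beta> *\<^sub>C mul N1 X X + \<gamma> *\<^sub>C Z) k = 0" for k by simp
    from this[unfolded c, of 1] this[unfolded c, of 2] this[unfolded c, of 3] X
    show ?r by simp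
  qed simp
qed

lemma adapted_spans:
  assumes "adapted X Z" and x: "x \<in> carr N1"
  obtains \<alpha> \<beta> \<gamma> where "x = \<alpha> *\<^sub>C X + \<beta> *\<^sub>C mul N1 X X + \<gamma> *\<^sub>C Z"
proof -
  have c: "(\<alpha> *\<^sub>C X + \<beta> *\<^sub>C mul N1 X X + \<gamma> *\<^sub>C Z) k =
    \<alpha> * X k + (if k = 2 then \<beta> * (X 1)\<^sup>2 else 0) + \<gamma> * Z k" for \<alpha> \<beta> \<gamma> k
    by (simp add: adapted_mul[OF assms(1)] scaleC_fun_def scaleC_complex_def e_def)
  have X: "X 1 \<noteq> 0" "Z 1 = 0" "Z 3 \<noteq> 0" "X \<in> carr N1" "Z \<in> carr N1" using assms(1) by (auto simp: adapted_def)
  define \<alpha> where "\<alpha> = x 1 / X 1"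
  define \<gamma> where "\<gamma> = (x 3 - \<alpha> * X 3) / Z 3"
  define \<beta> where "\<beta> = (x 2 - \<alpha> * X 2 - \<gamma> * Z 2) / (X 1)\<^sup>2"
  have "x k = (\<alpha> *\<^sub>C X + \<beta> *\<^sub>C mul N1 X X + \<gamma> *\<^sub>C Z) k" for k
  proof (cases "k \<in> {1..3}")
    case True
    then consider "k = 1" | "k = 2" | "k = 3" by fastforce
    then show ?thesis
    proof cases
      case 1 then show ?thesis using X unfolding c by (simp add: \<alpha>_def)
    next
      case 2 then show ?thesis using X unfolding c by (simp add: \<beta>_def)
    next
      case 3 then show ?thesis using X unfolding c by (simp add: \<gamma>_def)
    qed
  next
    case False
    then have "x k = 0" "X k = 0" "Z k = 0" using X(4,5) x unfolding carr_N1 supported_def mem_Collect_eq by metis+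
    moreover have "k \<noteq> 2" using False by auto
    ultimately show ?thesis unfolding c by simp
  qed
  then show thesis by (intro that) blast
qed

lemma adapted_e: "adapted (e 1) (e 3)"
  by (auto simp: adapted_def e_in_N1 e_apply)

lemma N1_decompose: "x \<in> carr N1 \<Longrightarrow> x = x 1 *\<^sub>C e 1 + x 2 *\<^sub>C mul N1 (e 1) (e 1) + x 3 *\<^sub>C e 3"
proof
  fix k assume x: "x \<in> carr N1"
  show "x k = (x 1 *\<^sub>C e 1 + x 2 *\<^sub>C mul N1 (e 1) (e 1) + x 3 *\<^sub>C e 3) k"
  proof (cases "k \<in> {1..3}")
    case True
    then consider "k = 1" | "k = 2" | "k = 3" by fastforce
    then show ?thesis by cases (simp_all add: mul_N1 e_def scaleC_fun_def scaleC_complex_def)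
  next
    case False
    then have "x k = 0" using x unfolding carr_N1 supported_def mem_Collect_eq by metis
    moreover have "k \<noteq> 1" "k \<noteq> 2" "k \<noteq> 3" using False by auto
    ultimately show ?thesis by (simp add: mul_N1 e_def scaleC_fun_def scaleC_complex_def)
  qed
qed

lemma cocycle_coordinates:
  assumes "\<theta> \<in> Z2 N1 V" "x \<in> carr N1" "y \<in> carr N1"
  shows "\<theta> x y = (x 1 * y 1) *\<^sub>C \<theta> (e 1) (e 1) + (x 1 * y 2 + 2 * x 2 * y 1) *\<^sub>C \<theta> (e 1) (e 2) +
    (x 1 * y 3) *\<^sub>C \<theta> (e 1) (e 3) + (x 3 * y 1) *\<^sub>C \<theta> (e 3) (e 1) + (x 3 * y 3) *\<^sub>C \<theta> (e 3) (e 3)"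
proof -
  have "mul N1 (e 1) (e 1) = e 2" by (simp add: mul_N1 e_def scaleC_one)
  then show ?thesis
    using cocycle_expand[OF assms(1) adapted_e, of "x 1" "x 2" "x 3" "y 1" "y 2" "y 3"]
      N1_decompose[OF assms(2)] N1_decompose[OF assms(3)] by simp
qed

section \<open>Structure vectors and changes of basis\<close>

text \<open>The values of \<open>\<theta>\<close> that determine the extension, read in some adapted basis. The basis is
  existentially quantified, so that a change of basis turns one such quadruple into another. The
  conditions that non-triviality imposes, \<open>a \<noteq> 0\<close> and the spanning property, are included because
  they do not depend on the basis.\<close>
definition structure_vectors ::
    "'v::complex_vector set \<Rightarrow> ((nat \<Rightarrow> complex) \<Rightarrow> (nat \<Rightarrow> complex) \<Rightarrow> 'v) \<Rightarrow> 'v \<Rightarrow> 'v \<Rightarrow> 'v \<Rightarrow> 'v \<Rightarrow> bool" where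
  "structure_vectors V \<theta> a b c d \<longleftrightarrow> a \<noteq> 0 \<and> cvs.span {a, b, c, d} = V \<and>
     (\<exists>X Z. adapted X Z \<and> a = \<theta> X (mul N1 X X) \<and> b = \<theta> X Z \<and> c = \<theta> Z X \<and> d = \<theta> Z Z)"

lemma structure_vectors_change:
  assumes "\<theta> \<in> Z2 N1 V" "structure_vectors V \<theta> a b c d" "x \<noteq> 0" "w \<noteq> 0"
  shows "structure_vectors V \<theta> ((x ^ 3) *\<^sub>C a) ((x * w) *\<^sub>C b + (x * s) *\<^sub>C a + (u * w) *\<^sub>C d)
    ((x * w) *\<^sub>C c + (2 * x * s) *\<^sub>C a + (u * w) *\<^sub>C d) ((w\<^sup>2) *\<^sub>C d)"
    (is "structure_vectors _ _ ?a ?b ?c ?d")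
proof -
  obtain X Z where XZ: "adapted X Z" and abcd: "a = \<theta> X (mul N1 X X)" "b = \<theta> X Z" "c = \<theta> Z X" "d = \<theta> Z Z"
    and a: "a \<noteq> 0" and V: "cvs.span {a, b, c, d} = V"
    using assms(2) unfolding structure_vectors_def by blast
  let ?Y = "mul N1 X X"
  have mem: "X \<in> carr N1" "Z \<in> carr N1" "X 1 \<noteq> 0" "Z 1 = 0" "Z 3 \<noteq> 0" using XZ by (auto simp: adapted_def)
  \<comment> \<open>the new basis vectors in terms of \<open>X\<close>, \<open>Y = X X\<close> and \<open>Z\<close>\<close>
  define X' where "X' = x *\<^sub>C X + 0 *\<^sub>C ?Y + u *\<^sub>C Z"
  define Z' where "Z' = 0 *\<^sub>C X + s *\<^sub>C ?Y + w *\<^sub>C Z"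
  have X'1: "X' 1 = x * X 1"
    using mem by (simp add: X'_def scaleC_fun_def scaleC_complex_def)
  have Y': "mul N1 X' X' = 0 *\<^sub>C X + x\<^sup>2 *\<^sub>C ?Y + 0 *\<^sub>C Z"
    unfolding mul_N1 X'1 by (simp add: scaleC_scaleC power2_eq_square mult_ac)
  have "adapted X' Z'"
  proof -
    have "X' \<in> carr N1" "Z' \<in> carr N1"
      unfolding X'_def Z'_def by (intro cvs.subspace_add cvs.subspace_scale subspace_N1 mul_N1_in mem)+
    moreover have "Z' 1 = 0" "Z' 3 = w * Z 3"
      using mem by (simp_all add: Z'_def mul_N1 scaleC_fun_def scaleC_complex_def e_apply)
    ultimately show ?thesis using mem assms(3,4) X'1 by (simp add: adapted_def)
  qed
  moreover have "?a = \<theta> X' (mul N1 X' X')" "?b = \<theta> X' Z'" "?c = \<theta> Z' X'" "?d = \<theta> Z' Z'"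
    unfolding Y' unfolding X'_def Z'_def abcd cocycle_expand[OF assms(1) XZ]
    by (simp_all add: power2_eq_square power3_eq_cube add_ac mult_ac)
  moreover have "?a \<noteq> 0" using a assms(3) by simp
  moreover have "cvs.span {?a, ?b, ?c, ?d} = V"
  proof
    show "cvs.span {?a, ?b, ?c, ?d} \<subseteq> V" unfolding V[symmetric]
      by (rule cvs.span_minimal)
        (auto intro!: cvs.span_add cvs.span_scale intro: cvs.span_base)
    let ?S = "cvs.span {?a, ?b, ?c, ?d}"
    have scale: "v \<in> ?S" if "k *\<^sub>C v \<in> ?S" "k \<noteq> 0" for k v
      using cvs.span_scale[OF that(1), of "inverse k"] that(2) by simp
    have A: "a \<in> ?S" by (rule scale[of "x ^ 3"]) (use assms in \<open>auto intro: cvs.span_base\<close>)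
    have D: "d \<in> ?S" by (rule scale[of "w\<^sup>2"]) (use assms in \<open>auto intro: cvs.span_base\<close>)
    have bc: "?b \<in> ?S" "?c \<in> ?S" by (auto intro: cvs.span_base)
    have "(x * w) *\<^sub>C b = ?b - (x * s) *\<^sub>C a - (u * w) *\<^sub>C d"
      "(x * w) *\<^sub>C c = ?c - (2 * x * s) *\<^sub>C a - (u * w) *\<^sub>C d" by simp_all
    moreover have "?b - (x * s) *\<^sub>C a - (u * w) *\<^sub>C d \<in> ?S" "?c - (2 * x * s) *\<^sub>C a - (u * w) *\<^sub>C d \<in> ?S"
      by (intro cvs.span_diff cvs.span_scale A D bc)+
    ultimately have "(x * w) *\<^sub>C b \<in> ?S" "(x * w) *\<^sub>C c \<in> ?S" by metis+
    then have "b \<in> ?S" "c \<in> ?S" using scale[of "x * w"] assms(3,4) no_zero_divisors[of x w] by blast+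
    then show "V \<subseteq> ?S" unfolding V[symmetric] using A D
      by (intro cvs.span_minimal cvs.subspace_span) auto
  qed
  ultimately show ?thesis unfolding structure_vectors_def by blast
qed

lemma structure_vectors_shift:
  assumes "\<theta> \<in> Z2 N1 V" "structure_vectors V \<theta> a b c d"
  shows "structure_vectors V \<theta> a (b + s *\<^sub>C a + u *\<^sub>C d) (c + (2 * s) *\<^sub>C a + u *\<^sub>C d) d"
  using structure_vectors_change[OF assms, of 1 1 s u] by (simp add: scaleC_one)

lemma structure_vectors_scale:
  assumes "\<theta> \<in> Z2 N1 V" "structure_vectors V \<theta> a b c d" "x \<noteq> 0" "w \<noteq> 0"
  shows "structure_vectors V \<theta> ((x ^ 3) *\<^sub>C a) ((x * w) *\<^sub>C b) ((x * w) *\<^sub>C c) ((w\<^sup>2) *\<^sub>C d)"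
  using structure_vectors_change[OF assms, of 0 0] by simp

text \<open>Shifting by \<open>s\<close> and \<open>u\<close> turns the coefficients \<open>\<beta>\<close>, \<open>\<delta>\<close> into \<open>\<beta> + s (1 - 2 \<alpha>)\<close> and
  \<open>\<delta> + u (1 - \<alpha>)\<close>, so a coefficient resists only for one value of \<open>\<alpha>\<close>. A coefficient that is already
  zero is left alone, also for that value; this matters when \<open>d\<close> is \<open>0\<close> or \<open>a\<close> and the
  decomposition of \<open>b\<close> can be chosen.\<close>
lemma structure_vectors_reduce_relation:
  assumes "\<theta> \<in> Z2 N1 V" "structure_vectors V \<theta> a b c d"
    and b: "b = \<alpha> *\<^sub>C c + \<beta> *\<^sub>C a + \<delta> *\<^sub>C d"
  obtains b' c' \<beta>' \<delta>' where "structure_vectors V \<theta> a b' c' d"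
    "b' = \<alpha> *\<^sub>C c' + \<beta>' *\<^sub>C a + \<delta>' *\<^sub>C d"
    "\<beta> = 0 \<or> \<alpha> \<noteq> 1 / 2 \<Longrightarrow> \<beta>' = 0" "\<delta> = 0 \<or> \<alpha> \<noteq> 1 \<Longrightarrow> \<delta>' = 0"
proof -
  define s where "s = (if \<beta> = 0 \<or> \<alpha> = 1 / 2 then 0 else \<beta> / (2 * \<alpha> - 1))"
  define u where "u = (if \<delta> = 0 \<or> \<alpha> = 1 then 0 else \<delta> / (\<alpha> - 1))"
  have "b + s *\<^sub>C a + u *\<^sub>C d = \<alpha> *\<^sub>C (c + (2 * s) *\<^sub>C a + u *\<^sub>C d) +
      (\<beta> + s - 2 * \<alpha> * s) *\<^sub>C a + (\<delta> + u - \<alpha> * u) *\<^sub>C d"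
    unfolding b by (simp add: algebra_simps scaleC_add_left cvs.scale_left_diff_distrib scaleC_add_right scaleC_scaleC)
  moreover have "\<beta> + s - 2 * \<alpha> * s = 0" if "\<beta> = 0 \<or> \<alpha> \<noteq> 1 / 2"
  proof (cases "\<beta> = 0")
    case False
    then have "2 * \<alpha> - 1 \<noteq> 0" using that by (simp add: field_simps)
    then show ?thesis using False that by (simp add: s_def field_simps)
  qed (simp add: s_def)
  moreover have "\<delta> + u - \<alpha> * u = 0" if "\<delta> = 0 \<or> \<alpha> \<noteq> 1"
  proof (cases "\<delta> = 0")
    case False
    then have "\<alpha> - 1 \<noteq> 0" using that by auto
    then show ?thesis using False that by (simp add: u_def field_simps)
  qed (simp add: u_def)
  ultimately show thesis
    by (intro that[OF structure_vectors_shift[OF assms(1,2), of s u], of "\<beta> + s - 2 * \<alpha> * s" "\<delta> + u - \<alpha> * u"])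
qed

lemma in_span1: "x \<in> cvs.span {a} \<Longrightarrow> \<exists>\<alpha>. x = \<alpha> *\<^sub>C a"
  by (auto simp: cvs.span_singleton)

lemma in_span2: "x \<in> cvs.span {d, a} \<Longrightarrow> \<exists>\<alpha> \<delta>. x = \<alpha> *\<^sub>C a + \<delta> *\<^sub>C d"
  by (auto simp: cvs.span_breakdown_eq[of _ d] cvs.span_singleton) (metis diff_add_cancel)

lemma in_span3: "x \<in> cvs.span {c, d, a} \<Longrightarrow> \<exists>\<alpha> \<beta> \<delta>. x = \<alpha> *\<^sub>C c + \<beta> *\<^sub>C a + \<delta> *\<^sub>C d"
proof -
  assume "x \<in> cvs.span {c, d, a}"
  then obtain k where "x - k *\<^sub>C c \<in> cvs.span {d, a}" by (auto simp: cvs.span_breakdown_eq[of _ c])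
  then obtain \<alpha> \<delta> where "x - k *\<^sub>C c = \<alpha> *\<^sub>C a + \<delta> *\<^sub>C d" using in_span2 by blast
  then have "x = k *\<^sub>C c + \<alpha> *\<^sub>C a + \<delta> *\<^sub>C d" by (simp add: algebra_simps)
  then show ?thesis by blast
qed

lemma structure_vectors_eliminate_c:
  assumes "\<theta> \<in> Z2 N1 V" "structure_vectors V \<theta> a b c d" "c \<in> cvs.span {d, a}"
  obtains b' where "structure_vectors V \<theta> a b' 0 d"
proof -
  obtain \<gamma> \<delta> where c: "c = \<gamma> *\<^sub>C a + \<delta> *\<^sub>C d" using in_span2[OF assms(3)] by blast
  have "c + (2 * (- \<gamma> / 2)) *\<^sub>C a + (- \<delta>) *\<^sub>C d = 0" unfolding c by simp
  then show thesis using structure_vectors_shift[OF assms(1,2), of "- \<gamma> / 2" "- \<delta>"] that by metis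
qed

text \<open>Over \<open>\<complex>\<close> the scaling \<open>d \<mapsto> w\<^sup>2 d\<close>, with \<open>a\<close> kept fixed, reaches every nonzero multiple of \<open>d\<close>.\<close>
lemma structure_vectors_normalize_d:
  assumes "\<theta> \<in> Z2 N1 V" "structure_vectors V \<theta> a b c (k *\<^sub>C a)" "k \<noteq> 0"
  obtains b' c' where "structure_vectors V \<theta> a b' c' a"
proof -
  define w where "w = 1 / csqrt k"
  have "w \<noteq> 0" "w\<^sup>2 * k = 1" using assms(3) by (simp_all add: w_def power_divide)
  then show thesis
    using structure_vectors_scale[OF assms(1,2), of 1 w] that by (simp add: scaleC_scaleC scaleC_one)
qed

text \<open>In the exceptional case \<open>\<alpha> = 1/2\<close> the term \<open>\<beta> a\<close> cannot be removed, but it can be scaled: the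
  stated \<open>w\<close> brings the relation into the form \<open>c = a + 2 b\<close> that occurs in the list.\<close>
lemma half_relation:
  assumes "b = (1 / 2) *\<^sub>C c + \<beta> *\<^sub>C a" "\<beta> \<noteq> 0" "w = - 1 / (2 * \<beta>)"
  shows "w *\<^sub>C c = a + (2 * w) *\<^sub>C b"
proof -
  have "(2 * w) *\<^sub>C b = (2 * w * (1 / 2)) *\<^sub>C c + (2 * w * \<beta>) *\<^sub>C a"
    by (simp only: assms(1) scaleC_add_right scaleC_scaleC)
  moreover have "2 * w * \<beta> = - 1" using assms(2,3) by simp
  ultimately show ?thesis by (simp add: scaleC_one)
qed

section \<open>Annihilator components\<close>

text \<open>The kernel of \<open>g\<close> contains all products, hence is an ideal, and it is a complement of the line
  through the central element \<open>z\<close>.\<close>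
lemma annihilator_componentI:
  assumes alg: "cvs.subspace (carr B)" "bilinear_on (carr B) (carr B) (mul B)"
    and z: "z \<in> Ann B"
    and g: "linear_on (carr B) (g :: _ \<Rightarrow> complex)" "g z = 1"
    and g0: "\<And>x y. x \<in> carr B \<Longrightarrow> y \<in> carr B \<Longrightarrow> g (mul B x y) = 0"
  shows "annihilator_component B (cvs.span {z})"
proof -
  let ?K = "{x \<in> carr B. g x = 0}"
  have zc: "z \<in> carr B" using z by (simp add: Ann_def)
  have mulc: "mul B x y \<in> carr B" if "x \<in> carr B" "y \<in> carr B" for x y
    using alg(2) that by (auto simp: bilinear_on_def)
  have span: "cvs.span {z} = range (\<lambda>c. c *\<^sub>C z)" by (rule cvs.span_singleton)
  have l: "mul B (c *\<^sub>C x) y = c *\<^sub>C mul B x y" "mul B y (c *\<^sub>C x) = c *\<^sub>C mul B y x"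
    if "x \<in> carr B" "y \<in> carr B" for c x y
    using alg(2) that by (auto simp: bilinear_on_def linear_on_def)
  have IA: "cvs.span {z} \<subseteq> Ann B"
    using z l zc alg(1) by (auto simp: span Ann_def cvs.subspace_scale)
  then have Ic: "cvs.span {z} \<subseteq> carr B" by (auto simp: Ann_def)
  have "z \<noteq> 0" using g linear_on_zero[OF g(1) alg(1)] by auto
  then have nz: "cvs.span {z} \<noteq> {0}" using cvs.span_superset[of "{z}"] by auto
  have K: "cvs.subspace ?K"
    using alg(1) linear_on_zero[OF g(1) alg(1)] linear_on_add[OF g(1)] linear_on_scale[OF g(1)]
    by (auto simp: cvs.subspace_def scaleC_complex_def)
  have iK: "ideal B ?K" unfolding ideal_def using K mulc g0 by auto
  have iI: "ideal B (cvs.span {z})"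
    unfolding ideal_def using Ic IA by (auto simp: Ann_def cvs.span_zero subset_iff)
  have gz: "g (c *\<^sub>C z) = c" for c
    using linear_on_scale[OF g(1) zc] g(2) by (simp add: scaleC_complex_def)
  have int: "?K \<inter> cvs.span {z} = {0}"
    using gz linear_on_zero[OF g(1) alg(1)] by (auto simp: span cvs.subspace_0[OF alg(1)] intro: image_eqI[of _ _ 0])
  have "x \<in> {x + y | x y. x \<in> ?K \<and> y \<in> cvs.span {z}}" if x: "x \<in> carr B" for x
  proof -
    have m: "(- g x) *\<^sub>C z \<in> carr B" using alg(1) zc by (rule cvs.subspace_scale)
    have "x + (- g x) *\<^sub>C z \<in> ?K"
      using linear_on_add[OF g(1) x m] gz[of "- g x"] cvs.subspace_add[OF alg(1) x m] by simp
    moreover have "x = (x + (- g x) *\<^sub>C z) + g x *\<^sub>C z" by simp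
    ultimately show ?thesis unfolding span by blast
  qed
  moreover have "{x + y | x y. x \<in> ?K \<and> y \<in> cvs.span {z}} \<subseteq> carr B"
    using Ic alg(1) by (auto intro!: cvs.subspace_add)
  ultimately have "carr B = {x + y | x y. x \<in> ?K \<and> y \<in> cvs.span {z}}" by blast
  with IA nz iK iI int show ?thesis unfolding annihilator_component_def
    using cvs.subspace_span by blast
qed

lemma fd_space_subspace: "fd_space V \<Longrightarrow> cvs.subspace V"
  by (auto simp: fd_space_def cvs.subspace_span)

lemma central_ext_algebra:
  assumes "\<theta> \<in> Z2 N1 V" "cvs.subspace V"
  shows "cvs.subspace (carr (central_ext N1 V \<theta>))"
    and "bilinear_on (carr (central_ext N1 V \<theta>)) (carr (central_ext N1 V \<theta>)) (mul (central_ext N1 V \<theta>))"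
proof -
  show "cvs.subspace (carr (central_ext N1 V \<theta>))"
    using assms(2) subspace_N1
    by (auto simp: central_ext_def cvs.subspace_def scaleC_prod_def zero_prod_def)
  show "bilinear_on (carr (central_ext N1 V \<theta>)) (carr (central_ext N1 V \<theta>)) (mul (central_ext N1 V \<theta>))"
    using assms(1) bilinear_N1
    by (auto simp: central_ext_def bilinear_on_def linear_on_def Z2_def scaleC_prod_def)
qed

text \<open>A basis of \<open>S\<close> remains independent when \<open>v\<close> is adjoined, so the values \<open>0\<close> on it and \<open>1\<close> at \<open>v\<close> can be
  prescribed.\<close>
lemma exists_functional:
  fixes S :: "'v::complex_vector set"
  assumes "cvs.subspace S" "v \<notin> S"
  obtains h where "linear_on UNIV (h :: 'v \<Rightarrow> complex)" "\<And>x. x \<in> S \<Longrightarrow> h x = 0" "h v = 1"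
proof -
  interpret vp: vector_space_pair "scaleC :: complex \<Rightarrow> 'v \<Rightarrow> 'v" "scaleC :: complex \<Rightarrow> complex \<Rightarrow> complex" ..
  obtain C where C: "C \<subseteq> S" "cvs.independent C" "S \<subseteq> cvs.span C"
    using cvs.maximal_independent_subset[of S] by blast
  have sp: "cvs.span C = S" using C assms(1) cvs.span_minimal by blast
  have ind: "cvs.independent (insert v C)" using C(2) assms(2) by (simp add: cvs.independent_insert sp)
  obtain h :: "'v \<Rightarrow> complex" where h: "Vector_Spaces.linear scaleC scaleC h" "\<forall>x\<in>insert v C. h x = (if x = v then 1 else 0)"
    using vp.linear_independent_extend[OF ind, of "\<lambda>x. if x = v then 1 else 0"] by blast
  have C0: "h x = 0" if "x \<in> C" for x using h(2) that assms(2) C(1) by auto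
  have "h x = 0" if "x \<in> S" for x
    using vp.linear_eq_0_on_span[OF h(1) C0, of C x] that sp by simp
  moreover have "linear_on UNIV h"
    using h(1) by (auto simp: linear_on_def vp.linear_add vp.linear_scale)
  ultimately show ?thesis using that h(2) by simp
qed

text \<open>A vector \<open>v\<close> outside the span would split off. The functional \<open>h\<close> that separates it from the
  span cannot be used directly, since the products of the extension also involve \<open>\<theta>(e\<^sub>1, e\<^sub>1)\<close>; but
  this term always comes together with \<open>e\<^sub>2\<close>, and subtracting \<open>h (\<theta>(e\<^sub>1, e\<^sub>1))\<close> times the
  \<open>e\<^sub>2\<close>-coordinate cancels it.\<close>
lemma non_split_span:
  assumes "\<theta> \<in> Z2 N1 V" "cvs.subspace V" "non_split (central_ext N1 V \<theta>)"
  shows "cvs.span {\<theta> (e 1) (e 2), \<theta> (e 1) (e 3), \<theta> (e 3) (e 1), \<theta> (e 3) (e 3)} = V" (is "cvs.span ?G = V")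
proof
  have mem: "\<theta> x y \<in> V" if "x \<in> carr N1" "y \<in> carr N1" for x y
    using assms(1) that by (auto simp: Z2_def bilinear_on_def)
  then have "?G \<subseteq> V" by (auto simp: e_in_N1)
  then show "cvs.span ?G \<subseteq> V" using assms(2) by (rule cvs.span_minimal)
  show "V \<subseteq> cvs.span ?G"
  proof (rule ccontr)
    let ?B = "central_ext N1 V \<theta>"
    assume "\<not> V \<subseteq> cvs.span ?G"
    then obtain v where v: "v \<in> V" "v \<notin> cvs.span ?G" by blast
    obtain h where h: "linear_on UNIV (h :: 'a \<Rightarrow> complex)" "\<And>x. x \<in> cvs.span ?G \<Longrightarrow> h x = 0" "h v = 1"
      using exists_functional[OF cvs.subspace_span v(2)] by blast
    have hG: "h (\<theta> (e 1) (e 2)) = 0" "h (\<theta> (e 1) (e 3)) = 0" "h (\<theta> (e 3) (e 1)) = 0" "h (\<theta> (e 3) (e 3)) = 0"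
      by (auto intro!: h(2) cvs.span_base)
    note hl = linear_on_add[OF h(1) UNIV_I UNIV_I] linear_on_scale[OF h(1) UNIV_I]
    define g where "g = (\<lambda>p :: (nat \<Rightarrow> complex) \<times> 'a. h (snd p) - fst p 2 * h (\<theta> (e 1) (e 1)))"
    have z: "\<theta> 0 x = 0" "\<theta> x 0 = 0" if "x \<in> carr N1" for x
      using cocycle_coordinates[OF assms(1) that cvs.subspace_0[OF subspace_N1]]
        cocycle_coordinates[OF assms(1) cvs.subspace_0[OF subspace_N1] that] by simp_all
    have "(0, v) \<in> Ann ?B"
      using v(1) z by (auto simp: Ann_def central_ext_def cvs.subspace_0[OF subspace_N1] mul_N1 zero_prod_def)
    moreover have "linear_on (carr ?B) g"
      by (auto simp: linear_on_def g_def hl scaleC_prod_def scaleC_fun_def scaleC_complex_def algebra_simps)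
    moreover have "g (0, v) = 1" by (simp add: g_def h(3))
    moreover have "g (mul ?B p q) = 0" if "p \<in> carr ?B" "q \<in> carr ?B" for p q
    proof -
      have pq: "fst p \<in> carr N1" "fst q \<in> carr N1" using that by (auto simp: central_ext_def)
      show ?thesis unfolding g_def central_ext_def
        by (simp add: cocycle_coordinates[OF assms(1) pq] hl hG mul_N1 scaleC_complex_def scaleC_fun_def e_apply del: One_nat_def)
    qed
    ultimately have "annihilator_component ?B (cvs.span {(0, v)})"
      by (intro annihilator_componentI[where g = g] central_ext_algebra assms)
    then show False using assms(3) by (auto simp: non_split_def)
  qed
qed

text \<open>If \<open>b = c = d = 0\<close> then \<open>Z\<close> is central. All products have vanishing \<open>e\<^sub>3\<close>-coordinate, which does not
  vanish at \<open>Z\<close>; so \<open>Z\<close> spans an annihilator component.\<close>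
lemma non_split_not_all_zero:
  assumes "\<theta> \<in> Z2 N1 V" "cvs.subspace V" "non_split (central_ext N1 V \<theta>)"
  shows "\<not> structure_vectors V \<theta> a 0 0 0"
proof
  let ?B = "central_ext N1 V \<theta>"
  assume "structure_vectors V \<theta> a 0 0 0"
  then obtain X Z where XZ: "adapted X Z" and 0: "\<theta> X Z = 0" "\<theta> Z X = 0" "\<theta> Z Z = 0"
    unfolding structure_vectors_def by metis
  have Z: "Z \<in> carr N1" "Z 1 = 0" "Z 3 \<noteq> 0" using XZ by (auto simp: adapted_def)
  have "\<theta> Z y = 0 \<and> \<theta> y Z = 0" if y: "y \<in> carr N1" for y
  proof -
    obtain \<alpha> \<beta> \<gamma> where comb: "y = \<alpha> *\<^sub>C X + \<beta> *\<^sub>C mul N1 X X + \<gamma> *\<^sub>C Z"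
      by (rule adapted_spans[OF XZ y])
    show ?thesis
      using cocycle_expand[OF assms(1) XZ, of \<alpha> \<beta> \<gamma> 0 0 1] cocycle_expand[OF assms(1) XZ, of 0 0 1 \<alpha> \<beta> \<gamma>]
      by (simp add: comb 0 scaleC_one)
  qed
  then have "(Z, 0) \<in> Ann ?B"
    using Z by (auto simp: Ann_def central_ext_def mul_N1 cvs.subspace_0[OF assms(2)] zero_prod_def)
  moreover have "linear_on (carr ?B) (\<lambda>p. fst p 3 / Z 3)"
    by (auto simp: linear_on_def scaleC_prod_def scaleC_fun_def scaleC_complex_def add_divide_distrib)
  moreover have "fst (Z, 0::'a) 3 / Z 3 = 1" using Z by simp
  moreover have "fst (mul ?B p q) 3 / Z 3 = 0" for p q
    by (simp add: central_ext_def mul_N1 scaleC_fun_def scaleC_complex_def e_def)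
  ultimately have "annihilator_component ?B (cvs.span {(Z, 0)})"
    by (intro annihilator_componentI[where g = "\<lambda>p. fst p 3 / Z 3"] central_ext_algebra assms)
  then show False using assms(3) by (auto simp: non_split_def)
qed

section \<open>Coordinates with respect to a list of vectors\<close>

text \<open>The vectors of the list take the places \<open>4, 5, \<dots>\<close>: they are to become the basis elements
  \<open>e\<^sub>4, e\<^sub>5, \<dots>\<close> of an extension, after the three basis elements of the algebra itself. Entries of
  \<open>w\<close> at smaller indices are ignored.\<close>
definition combination :: "'v::complex_vector list \<Rightarrow> (nat \<Rightarrow> complex) \<Rightarrow> 'v" where
  "combination vs w = (\<Sum>k<length vs. w (k + 4) *\<^sub>C vs ! k)"

lemma combination_add: "combination vs (w + w') = combination vs w + combination vs w'"
  by (simp add: combination_def scaleC_add_left sum.distrib)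

lemma combination_scale: "combination vs (c *\<^sub>C w) = c *\<^sub>C combination vs w"
  by (simp add: combination_def cvs.scale_sum_right scaleC_fun_def scaleC_complex_def scaleC_scaleC)

lemma combination_eq_0_below: "(\<And>k. 4 \<le> k \<Longrightarrow> w k = 0) \<Longrightarrow> combination vs w = 0"
  by (simp add: combination_def)

lemma combination_in_span: "combination vs w \<in> cvs.span (set vs)"
  unfolding combination_def by (intro cvs.span_sum cvs.span_scale cvs.span_base) auto

lemma combination_bij:
  fixes vs :: "'v::complex_vector list"
  assumes "distinct vs" "cvs.independent (set vs)"
  shows "bij_betw (combination vs) (supported {4..<4 + length vs}) (cvs.span (set vs))"
proof -
  let ?n = "length vs"
  have nth: "bij_betw ((!) vs) {..<?n} (set vs)" using assms(1) by (rule bij_betw_nth) auto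
  have re: "combination vs w = (\<Sum>v\<in>set vs. w (the_inv_into {..<?n} ((!) vs) v + 4) *\<^sub>C v)" for w
    unfolding combination_def sum.reindex_bij_betw[OF nth, symmetric]
    using nth by (intro sum.cong) (auto simp: the_inv_into_f_f bij_betw_def)
  have "inj_on (combination vs) (supported {4..<4 + ?n})"
  proof (rule inj_onI)
    fix w w' assume w: "w \<in> supported {4..<4 + ?n}" "w' \<in> supported {4..<4 + ?n}"
      and eq: "combination vs w = combination vs w'"
    have "combination vs (w - w') = 0" using eq combination_add[of vs "w - w'" w'] by simp
    then have "(w - w') (the_inv_into {..<?n} ((!) vs) v + 4) = 0" if "v \<in> set vs" for v
      using cvs.independentD[OF assms(2) finite_set order_refl _ that,
          of "\<lambda>v. (w - w') (the_inv_into {..<?n} ((!) vs) v + 4)"] unfolding re by blast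
    from this[OF nth_mem] have d: "(w - w') (k + 4) = 0" if "k < ?n" for k
      using nth that by (simp add: the_inv_into_f_f bij_betw_def)
    show "w = w'"
    proof
      fix k show "w k = w' k"
      proof (cases "k \<in> {4..<4 + ?n}")
        case True then show ?thesis using d[of "k - 4"] by auto
      next
        case False then show ?thesis using w by (simp add: supported_def)
      qed
    qed
  qed
  moreover have "v \<in> combination vs ` supported {4..<4 + ?n}" if v: "v \<in> cvs.span (set vs)" for v
  proof -
    obtain r :: "'v \<Rightarrow> complex" where r: "v = (\<Sum>x\<in>set vs. r x *\<^sub>C x)"
      using v unfolding cvs.span_finite[OF finite_set] by blast
    define w where "w = (\<lambda>k. if k \<in> {4..<4 + ?n} then r (vs ! (k - 4)) else 0)"
    have "combination vs w = (\<Sum>k<?n. r (vs ! k) *\<^sub>C vs ! k)"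
      unfolding combination_def w_def by (rule sum.cong) auto
    also have "\<dots> = v" unfolding r by (rule sum.reindex_bij_betw[OF nth])
    finally show ?thesis by (auto simp: w_def supported_def)
  qed
  ultimately show ?thesis using combination_in_span unfolding bij_betw_def by blast
qed

section \<open>Extensions with vanishing first structure vector\<close>

text \<open>If \<open>a = 0\<close>, no value of \<open>\<theta>\<close> depends on \<open>e\<^sub>2\<close>-coordinates. Then \<open>e\<^sub>2\<close> can be moved from the algebra to
  the kernel: the extension is a central extension of the two-dimensional zero algebra with basis
  \<open>e\<^sub>1, e\<^sub>3\<close> by \<open>\<complex> e\<^sub>2 \<oplus> V\<close>.\<close>
lemma nontrivial_ext_imp_nonzero:
  fixes V :: "'v::complex_vector set"
  assumes "fd_space V" and Z2: "\<theta> \<in> Z2 N1 V" and nt: "nontrivial_ext N1 V \<theta>"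
  shows "\<theta> (e 1) (e 2) \<noteq> 0"
proof
  assume a0: "\<theta> (e 1) (e 2) = 0"
  obtain B where "finite B" "V = cvs.span B" using assms(1) by (auto simp: fd_space_def)
  moreover from this(1) obtain C where C: "C \<subseteq> B" "cvs.independent C" "B \<subseteq> cvs.span C"
    using cvs.maximal_independent_subset[of B] by blast
  ultimately have "finite C" "cvs.span C = V"
    using finite_subset cvs.span_eq[of B C] cvs.span_superset[of B] by blast+
  then obtain vs where vs: "set vs = C" "distinct vs" using finite_distinct_list by blast
  let ?n = "length vs" and ?S = "supported {4..<4 + length vs}" and ?\<psi> = "combination vs"
  have bij: "bij_betw ?\<psi> ?S V"
    using combination_bij[OF vs(2)] vs(1) C(2) \<open>cvs.span C = V\<close> by simp
  define \<phi> where "\<phi> = inv_into ?S ?\<psi>"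
  have \<phi>lin: "linear_on V \<phi>"
    unfolding \<phi>_def by (intro linear_on_inv_into bij subspace_supported)
      (simp add: linear_on_def combination_add combination_scale)
  have \<phi>S: "\<phi> v \<in> ?S" "?\<psi> (\<phi> v) = v" if "v \<in> V" for v
    using that bij bij_betwE[OF bij_betw_inv_into[OF bij]] unfolding \<phi>_def by (auto simp: bij_betw_inv_into_right)
  have \<phi>\<psi>: "\<phi> (?\<psi> w) = w" if "w \<in> ?S" for w
    using that bij unfolding \<phi>_def by (simp add: bij_betw_inv_into_left)
  have subV: "cvs.subspace V" using assms(1) by (rule fd_space_subspace)
  have thV: "\<theta> x y \<in> V" if "x \<in> carr N1" "y \<in> carr N1" for x y
    using Z2 that by (auto simp: Z2_def bilinear_on_def)
  \<comment> \<open>\<open>?W\<close> models \<open>\<complex> e\<^sub>2 \<oplus> V\<close>: index 3 holds the \<open>e\<^sub>2\<close>-coordinate, the indices from 4 on hold \<open>V\<close>\<close>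
  let ?C = "table_alg 2 []" and ?W = "supported {3..?n + 3}"
  have SW: "w \<in> ?S \<Longrightarrow> w \<in> ?W" for w by (auto simp: supported_def)
  have carrC: "carr ?C = supported {1..2}" by (rule carr_table_alg)
  have mulC: "mul ?C x y = 0" for x y by (simp add: table_alg_def table_entry_def)
  have Czin: "zinbiel ?C"
    using fd_space_supported[of 1 2] cvs.subspace_0[OF subspace_supported]
    by (simp add: zinbiel_def algebra_def mulC bilinear_on_def linear_on_def carrC)
  have fdW: "fd_space ?W" by (rule fd_space_supported)
  have dim: "alg_dim ?C < alg_dim N1" unfolding N1_def alg_dim_table_alg by simp
  \<comment> \<open>\<open>\<eta>\<close> is the product of \<open>e\<^sub>1\<close> and \<open>e\<^sub>3\<close> in the extension, these being renamed to \<open>e\<^sub>1\<close> and \<open>e\<^sub>2\<close>;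
    the summand \<open>e 3\<close> of \<open>p\<close> is the old \<open>e\<^sub>2 = e\<^sub>1 e\<^sub>1\<close>\<close>
  define p where "p = e 3 + \<phi> (\<theta> (e 1) (e 1))"
  define q where "q = \<phi> (\<theta> (e 1) (e 3))"
  define r where "r = \<phi> (\<theta> (e 3) (e 1))"
  define t where "t = \<phi> (\<theta> (e 3) (e 3))"
  define \<eta> where "\<eta> = (\<lambda>(x :: nat \<Rightarrow> complex) (y :: nat \<Rightarrow> complex). (x 1 * y 1) *\<^sub>C p + (x 1 * y 2) *\<^sub>C q + (x 2 * y 1) *\<^sub>C r + (x 2 * y 2) *\<^sub>C t)"
  have W: "p \<in> ?W" "q \<in> ?W" "r \<in> ?W" "t \<in> ?W"
  proof -
    have "\<phi> (\<theta> (e i) (e j)) \<in> ?W" if "i \<in> {1..3}" "j \<in> {1..3}" for i j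
      by (intro SW \<phi>S thV e_in_N1 that)
    then show "p \<in> ?W" "q \<in> ?W" "r \<in> ?W" "t \<in> ?W"
      unfolding p_def q_def r_def t_def by (simp_all add: cvs.subspace_add[OF subspace_supported] e_in_supported)
  qed
  have \<eta>: "\<eta> \<in> Z2 ?C ?W"
  proof -
    have "\<eta> x y \<in> ?W" for x y
      unfolding \<eta>_def by (intro cvs.subspace_add cvs.subspace_scale subspace_supported W)
    then show ?thesis
      unfolding Z2_def bilinear_on_def linear_on_def mem_Collect_eq mulC
      by (simp add: \<eta>_def scaleC_add_right scaleC_scaleC scaleC_add_left distrib_left distrib_right)
        (simp add: scaleC_fun_def scaleC_complex_def scaleC_add_left scaleC_add_right fun_eq_iff algebra_simps)
  qed
  define f where "f = (\<lambda>u :: (nat \<Rightarrow> complex) \<times> 'v.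
    (fst u 1 *\<^sub>C e 1 + fst u 3 *\<^sub>C e 2, fst u 2 *\<^sub>C e 3 + \<phi> (snd u)))"
  define g where "g = (\<lambda>u :: (nat \<Rightarrow> complex) \<times> (nat \<Rightarrow> complex). (fst u 1 *\<^sub>C e 1 + snd u 3 *\<^sub>C e 2 + fst u 2 *\<^sub>C e 3, ?\<psi> (snd u)))"
  let ?B = "central_ext N1 V \<theta>" and ?D = "central_ext ?C ?W \<eta>"
  have carr: "carr ?B = carr N1 \<times> V" "carr ?D = supported {1..2} \<times> ?W"
    by (simp_all add: central_ext_def carrC)
  have e0: "?\<psi> (e 3) = 0" by (intro combination_eq_0_below) (auto simp: e_def)
  have "bij_betw f (carr ?B) (carr ?D)"
  proof (rule bij_betw_byWitness[where f' = g])
    show "\<forall>u\<in>carr ?B. g (f u) = u"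
    proof
      fix u assume u: "u \<in> carr ?B"
      then have u': "fst u \<in> carr N1" "snd u \<in> V" by (auto simp: carr)
      have "\<phi> (snd u) 3 = 0" using \<phi>S(1)[OF u'(2)] by (simp add: supported_def)
      moreover have "fst u = fst u 1 *\<^sub>C e 1 + fst u 2 *\<^sub>C e 2 + fst u 3 *\<^sub>C e 3"
        using N1_decompose[OF u'(1)] by (simp add: mul_N1 e_apply scaleC_one del: One_nat_def)
      ultimately show "g (f u) = u"
        using \<phi>S(2)[OF u'(2)]
        by (simp add: g_def f_def prod_eq_iff combination_add combination_scale e0)
          (simp add: scaleC_fun_def scaleC_complex_def e_apply)
    qed
    show "\<forall>u\<in>carr ?D. f (g u) = u"
    proof
      fix u assume u: "u \<in> carr ?D"
      then have u': "fst u \<in> supported {1..2}" "snd u \<in> ?W" by (auto simp: carr)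
      have "fst u k = fst (f (g u)) k" for k
      proof (cases "k \<in> {1..2}")
        case True
        then have "k = 1 \<or> k = 2" by auto
        then show ?thesis by (auto simp: f_def g_def scaleC_fun_def scaleC_complex_def e_apply)
      next
        case False
        then have "fst u k = 0" "k \<noteq> 1" "k \<noteq> 2" using u'(1) by (auto simp: supported_def)
        then show ?thesis by (simp add: f_def g_def scaleC_fun_def scaleC_complex_def e_apply)
      qed
      moreover have "snd u = snd (f (g u))"
      proof -
        let ?w = "snd u - snd u 3 *\<^sub>C e 3"
        have "?w k = 0" if "k \<notin> {4..<4 + ?n}" for k
        proof (cases "k = 3")
          case True then show ?thesis by (simp add: scaleC_fun_def scaleC_complex_def e_apply)
        next
          case False
          then have "k \<notin> {3..?n + 3}" using that by auto
          then show ?thesis using u'(2) False by (simp add: supported_def scaleC_fun_def scaleC_complex_def e_apply)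
        qed
        then have "?w \<in> ?S" unfolding supported_def by blast
        moreover have "?\<psi> (snd u) = ?\<psi> ?w"
          using combination_add[of vs ?w "snd u 3 *\<^sub>C e 3"] by (simp add: combination_scale e0)
        ultimately have "\<phi> (?\<psi> (snd u)) = ?w" using \<phi>\<psi> by metis
        moreover have "fst (g u) 2 = snd u 3"
          by (simp add: g_def scaleC_fun_def scaleC_complex_def e_apply)
        ultimately show ?thesis by (simp add: f_def) (simp add: g_def)
      qed
      ultimately show "f (g u) = u" by (simp add: prod_eq_iff fun_eq_iff)
    qed
    show "f ` carr ?B \<subseteq> carr ?D"
      using \<phi>S(1) SW
      by (auto simp: carr f_def e_in_supported intro!: cvs.subspace_add cvs.subspace_scale subspace_supported)
    show "g ` carr ?D \<subseteq> carr ?B"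
      using combination_in_span[of vs] vs(1) \<open>cvs.span C = V\<close>
      by (auto simp: carr g_def e_in_N1 intro!: cvs.subspace_add cvs.subspace_scale subspace_N1)
  qed
  moreover have "linear_on (carr ?B) f"
    by (auto simp: linear_on_def carr f_def linear_on_add[OF \<phi>lin] linear_on_scale[OF \<phi>lin]
        scaleC_prod_def scaleC_add_left scaleC_add_right scaleC_scaleC add_ac)
      (simp_all add: scaleC_fun_def scaleC_complex_def fun_eq_iff algebra_simps)
  moreover have "f (mul ?B u v) = mul ?D (f u) (f v)" if "u \<in> carr ?B" "v \<in> carr ?B" for u v
  proof -
    have uv: "fst u \<in> carr N1" "fst v \<in> carr N1" using that by (auto simp: carr)
    have th: "\<theta> (e 1) (e 1) \<in> V" "\<theta> (e 1) (e 3) \<in> V" "\<theta> (e 3) (e 1) \<in> V" "\<theta> (e 3) (e 3) \<in> V"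
      by (simp_all add: thV e_in_N1)
    have "\<phi> (\<theta> (fst u) (fst v)) = (fst u 1 * fst v 1) *\<^sub>C \<phi> (\<theta> (e 1) (e 1)) + (fst u 1 * fst v 3) *\<^sub>C q
      + (fst u 3 * fst v 1) *\<^sub>C r + (fst u 3 * fst v 3) *\<^sub>C t"
      unfolding cocycle_coordinates[OF Z2 uv] a0 q_def r_def t_def
      by (simp add: linear_on_add[OF \<phi>lin] linear_on_scale[OF \<phi>lin] th cvs.subspace_add[OF subV]
          cvs.subspace_scale[OF subV] del: One_nat_def)
    then show ?thesis
      by (simp add: f_def central_ext_def mulC mul_N1 \<eta>_def p_def zero_prod_def)
        (simp add: scaleC_fun_def scaleC_complex_def e_apply fun_eq_iff zero_fun_def algebra_simps)
  qed
  ultimately have "?B \<cong>\<^sub>a ?D" unfolding alg_iso_def by blast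
  then show False using nt Czin dim fdW \<eta> unfolding nontrivial_ext_def by blast
qed

section \<open>Reading off an isomorphism from structure vectors\<close>

text \<open>All algebras of the list have this shape; they differ in the vectors \<open>p, q, r, t\<close>, which are the
  coordinates of \<open>a, b, c, d\<close>.\<close>
definition normal_table ::
    "(nat \<Rightarrow> complex) \<Rightarrow> (nat \<Rightarrow> complex) \<Rightarrow> (nat \<Rightarrow> complex) \<Rightarrow> (nat \<Rightarrow> complex) \<Rightarrow>
     ((nat \<times> nat) \<times> (nat \<Rightarrow> complex)) list" where
  "normal_table p q r t =
     [((1,1), e 2), ((1,2), p), ((2,1), 2 *\<^sub>C p), ((1,3), q), ((3,1), r), ((3,3), t)]"

lemma mul_normal_table:
  "mul (table_alg (n + 3) (normal_table p q r t)) x y =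
     (x 1 * y 1) *\<^sub>C e 2 + (x 1 * y 2 + 2 * x 2 * y 1) *\<^sub>C p + (x 1 * y 3) *\<^sub>C q +
     (x 3 * y 1) *\<^sub>C r + (x 3 * y 3) *\<^sub>C t"
proof -
  let ?f = "\<lambda>i j. (x i * y j) *\<^sub>C table_entry (normal_table p q r t) i j"
  have z: "?f i j = 0" if "i \<notin> {1..3} \<or> j \<notin> {1..3}" for i j
    using that by (auto simp: table_entry_def normal_table_def)
  have "(\<Sum>i=1..n+3. \<Sum>j=1..n+3. ?f i j) = (\<Sum>i=1..n+3. \<Sum>j=1..3. ?f i j)"
    by (intro sum.cong refl sum.mono_neutral_right) (auto simp: z)
  also have "\<dots> = (\<Sum>i=1..3. \<Sum>j=1..3. ?f i j)"
    by (intro sum.mono_neutral_right ballI sum.neutral) (auto simp: z)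
  also have "\<dots> = (x 1 * y 1) *\<^sub>C e 2 + (x 1 * y 2 + 2 * x 2 * y 1) *\<^sub>C p + (x 1 * y 3) *\<^sub>C q +
     (x 3 * y 1) *\<^sub>C r + (x 3 * y 3) *\<^sub>C t"
    by (simp add: numeral_3_eq_3 numeral_2_eq_2 table_entry_def normal_table_def scaleC_add_left scaleC_scaleC add_ac mult_ac)
  finally show ?thesis by (simp add: table_alg_def)
qed

text \<open>The isomorphism, constructed from right to left, sends \<open>e\<^sub>1, e\<^sub>2, e\<^sub>3\<close> to \<open>X\<close>, its square in the
  extension and \<open>Z\<close>, and \<open>e\<^sub>4, e\<^sub>5, \<dots>\<close> to the vectors of the list. That these form a basis of \<open>V\<close>
  follows from their number, because \<open>a, b, c, d\<close> span \<open>V\<close> and are combinations of them. Hence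
  only the relations between the four vectors have to be known in an application.\<close>
lemma central_ext_iso_table:
  assumes "\<theta> \<in> Z2 N1 V" and S: "structure_vectors V \<theta> a b c d"
    and vs: "set vs \<subseteq> {a, b, c, d}" "length vs = cvs.dim V"
    and abcd: "a = combination vs p" "b = combination vs q" "c = combination vs r" "d = combination vs t"
    and supp: "{p, q, r, t} \<subseteq> supported {4..<4 + length vs}"
  shows "central_ext N1 V \<theta> \<cong>\<^sub>a table_alg (length vs + 3) (normal_table p q r t)"
proof -
  let ?n = "length vs" and ?B = "central_ext N1 V \<theta>"
  let ?T = "table_alg (?n + 3) (normal_table p q r t)"
  obtain X Z where XZ: "adapted X Z" and th: "\<theta> X (mul N1 X X) = a" "\<theta> X Z = b" "\<theta> Z X = c" "\<theta> Z Z = d"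
    and V: "cvs.span {a, b, c, d} = V" using S unfolding structure_vectors_def by blast
  have subV: "cvs.subspace V" using V cvs.subspace_span by metis
  have memX: "X \<in> carr N1" "Z \<in> carr N1" using XZ by (auto simp: adapted_def)
  have span: "cvs.span (set vs) = V"
  proof
    show "cvs.span (set vs) \<subseteq> V" unfolding V[symmetric] by (rule cvs.span_mono[OF vs(1)])
    have "{a, b, c, d} \<subseteq> cvs.span (set vs)" using abcd combination_in_span by auto
    then show "V \<subseteq> cvs.span (set vs)" unfolding V[symmetric] by (intro cvs.span_minimal cvs.subspace_span)
  qed
  have card: "card (set vs) = ?n"
    using vs(2) card_length[of vs] cvs.dim_le_card[of V "set vs"] span by auto
  then have dist: "distinct vs" by (rule card_distinct)
  have ind: "cvs.independent (set vs)"
  proof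
    assume "cvs.dependent (set vs)"
    then obtain v where v: "v \<in> set vs" "v \<in> cvs.span (set vs - {v})" by (auto simp: cvs.dependent_def)
    then have "cvs.span (set vs - {v}) = V"
      using cvs.span_redundant[OF v(2)] span by (simp add: insert_absorb)
    then have "cvs.dim V \<le> card (set vs - {v})" by (intro cvs.dim_le_card) auto
    then show False using v(1) card vs(2) card_gt_0_iff[of "set vs"] by auto
  qed
  note bij = combination_bij[OF dist ind, unfolded span]
  note comb = combination_add[of vs] combination_scale[of vs]
  \<comment> \<open>the term \<open>y 2 *\<^sub>C \<theta> X X\<close> makes the image of \<open>e 2\<close> the square of \<open>(X, 0)\<close>, absorbing the coboundary\<close>
  define f where "f = (\<lambda>y. (y 1 *\<^sub>C X + y 2 *\<^sub>C mul N1 X X + y 3 *\<^sub>C Z, y 2 *\<^sub>C \<theta> X X + combination vs y))"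
  have carrT: "carr ?T = supported {1..?n + 3}" by (rule carr_table_alg)
  have thV: "\<theta> x y \<in> V" if "x \<in> carr N1" "y \<in> carr N1" for x y
    using assms(1) that by (auto simp: Z2_def bilinear_on_def)
  have f_add: "f (x + y) = f x + f y" for x y
    by (simp add: f_def comb scaleC_add_left add_ac)
  have f_scale: "f (k *\<^sub>C x) = k *\<^sub>C f x" for k x
    by (simp add: f_def comb scaleC_prod_def scaleC_add_right scaleC_scaleC)
      (simp add: scaleC_fun_def scaleC_complex_def)
  have "linear_on (carr ?T) f" by (simp add: linear_on_def f_add f_scale)
  moreover have "bij_betw f (carr ?T) (carr ?B)"
    unfolding bij_betw_def
  proof
    have ker: "y = 0" if y: "y \<in> supported {1..?n + 3}" "f y = 0" for y
    proof -
      have y123: "y 1 = 0" "y 2 = 0" "y 3 = 0"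
        using y(2) by (simp_all add: f_def zero_prod_def adapted_independent[OF XZ])
      have "y \<in> supported {4..<4 + ?n}"
        unfolding supported_def
      proof (clarify)
        fix k assume "k \<notin> {4..<4 + ?n}"
        then have "k \<notin> {1..?n + 3} \<or> k = 1 \<or> k = 2 \<or> k = 3" by auto
        then show "y k = 0" using y(1) y123 by (auto simp: supported_def)
      qed
      moreover have "combination vs y = combination vs 0"
        using y(2) y123 by (simp add: f_def zero_prod_def combination_eq_0_below)
      ultimately show ?thesis
        using bij cvs.subspace_0[OF subspace_supported] by (auto simp: bij_betw_def inj_on_def)
    qed
    show "inj_on f (carr ?T)"
    proof (rule inj_onI)
      fix x y assume xy: "x \<in> carr ?T" "y \<in> carr ?T" "f x = f y"
      have "f (x - y) = 0" using f_add[of "x - y" y] xy(3) by simp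
      then show "x = y"
        using ker[of "x - y"] xy(1,2) cvs.subspace_diff[OF subspace_supported] unfolding carrT by simp
    qed
    have "f y \<in> carr ?B" for y
      unfolding f_def central_ext_def
      using subspace_N1 memX mul_N1_in subV thV[OF memX(1) memX(1)] combination_in_span[of vs y] span
      by (auto intro!: cvs.subspace_add cvs.subspace_scale)
    moreover have "(x, v) \<in> f ` carr ?T" if xv: "x \<in> carr N1" "v \<in> V" for x v
    proof -
      obtain \<alpha> \<beta> \<gamma> where x: "x = \<alpha> *\<^sub>C X + \<beta> *\<^sub>C mul N1 X X + \<gamma> *\<^sub>C Z"
        by (rule adapted_spans[OF XZ xv(1)])
      have "v - \<beta> *\<^sub>C \<theta> X X \<in> V"
        by (intro cvs.subspace_diff cvs.subspace_scale subV xv thV memX)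
      then obtain w where w: "w \<in> supported {4..<4 + ?n}" "combination vs w = v - \<beta> *\<^sub>C \<theta> X X"
        using bij unfolding bij_betw_def by (metis imageE)
      let ?y = "\<alpha> *\<^sub>C e 1 + \<beta> *\<^sub>C e 2 + \<gamma> *\<^sub>C e 3 + w"
      have w0: "w 1 = 0" "w 2 = 0" "w 3 = 0" using w(1) by (auto simp: supported_def)
      have e0: "combination vs (e k) = 0" if "k \<le> 3" for k
        using that by (intro combination_eq_0_below) (auto simp: e_def)
      have "?y 1 = \<alpha>" "?y 2 = \<beta>" "?y 3 = \<gamma>"
        by (simp_all add: w0[simplified] scaleC_fun_def scaleC_complex_def e_apply)
      moreover have "combination vs ?y = v - \<beta> *\<^sub>C \<theta> X X"
        by (simp add: comb w(2) e0 del: One_nat_def)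
      ultimately have "f ?y = (x, v)" by (simp add: f_def x del: One_nat_def)
      moreover have "?y \<in> carr ?T"
        using w(1) unfolding carrT
        by (intro cvs.subspace_add cvs.subspace_scale subspace_supported) (auto simp: e_in_supported, auto simp: supported_def)
      ultimately show ?thesis by (metis imageI)
    qed
    ultimately show "f ` carr ?T = carr ?B" by (fastforce simp: central_ext_def)
  qed
  moreover have mulT: "mul ?T x y \<in> carr ?T" for x y
  proof -
    have "{p, q, r, t} \<subseteq> supported {1..?n + 3}" using supp by (auto simp: supported_def)
    then show ?thesis unfolding mul_normal_table carrT
      by (intro cvs.subspace_add cvs.subspace_scale subspace_supported) (auto simp: e_in_supported)
  qed
  moreover have "f (mul ?T x y) = mul ?B (f x) (f y)" for x y
  proof -
    have m: "p k = 0" "q k = 0" "r k = 0" "t k = 0" if "k \<in> {1, 2, 3}" for k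
      using supp that by (auto simp: supported_def)
    have e2: "combination vs (e 2) = 0" by (intro combination_eq_0_below) (auto simp: e_def)
    have m123: "mul ?T x y 1 = 0" "mul ?T x y 2 = x 1 * y 1" "mul ?T x y 3 = 0"
      unfolding mul_normal_table by (simp_all add: m[simplified] scaleC_fun_def scaleC_complex_def e_apply)
    have "combination vs (mul ?T x y) = (x 1 * y 2 + 2 * x 2 * y 1) *\<^sub>C a + (x 1 * y 3) *\<^sub>C b +
      (x 3 * y 1) *\<^sub>C c + (x 3 * y 3) *\<^sub>C d"
      unfolding mul_normal_table by (simp add: comb abcd e2)
    moreover have "\<theta> (fst (f x)) (fst (f y)) = (x 1 * y 1) *\<^sub>C \<theta> X X + (x 1 * y 2 + 2 * x 2 * y 1) *\<^sub>C a
      + (x 1 * y 3) *\<^sub>C b + (x 3 * y 1) *\<^sub>C c + (x 3 * y 3) *\<^sub>C d"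
      by (simp add: f_def cocycle_expand[OF assms(1) XZ] th)
    moreover have "mul N1 (fst (f x)) (fst (f y)) = (x 1 * y 1) *\<^sub>C mul N1 X X"
      using XZ by (simp add: f_def mul_N1 adapted_def scaleC_fun_def scaleC_complex_def e_apply mult_ac)
    ultimately show ?thesis
      by (simp add: central_ext_def del: One_nat_def)
        (simp add: f_def m123 add.assoc del: One_nat_def)
  qed
  ultimately have "?T \<cong>\<^sub>a ?B" unfolding alg_iso_def by blast
  then show ?thesis using alg_iso_sym mulT subspace_table_alg by blast
qed

lemma scaleC_apply: "(c *\<^sub>C w) k = c * w k" for w :: "nat \<Rightarrow> complex"
  by (simp add: scaleC_fun_def scaleC_complex_def)

lemma table_alg_cong:
  "(\<And>i j. table_entry T i j = table_entry T' i j) \<Longrightarrow> table_alg n T = table_alg n T'"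
  by (simp add: table_alg_def)

text \<open>Products that a table of the list omits are explicit zeros here, which gives all of the algebras
  one common shape.\<close>
lemma listed_algebras_normal:
  "N1_1_01 = table_alg (1 + 3) (normal_table (e 4) 0 0 (e 4))"
  "N1_1_02 = table_alg (1 + 3) (normal_table (e 4) (e 4) 0 0)"
  "N1_2_01 = table_alg (2 + 3) (normal_table (e 4) (e 5) 0 0)"
  "N1_2_02 \<alpha> = table_alg (2 + 3) (normal_table (e 4) (\<alpha> *\<^sub>C e 5) (e 5) 0)"
  "N1_2_03 = table_alg (2 + 3) (normal_table (e 4) (e 5) 0 (e 5))"
  "N1_2_04 = table_alg (2 + 3) (normal_table (e 4) 0 0 (e 5))"
  "N1_2_05 = table_alg (2 + 3) (normal_table (e 4) (e 4) 0 (e 5))"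
  "N1_2_06 = table_alg (2 + 3) (normal_table (e 4) (e 4 + e 5) 0 (e 5))"
  "N1_2_07 = table_alg (2 + 3) (normal_table (e 4) (e 5) (e 4 + 2 *\<^sub>C e 5) 0)"
  "N1_2_08 = table_alg (2 + 3) (normal_table (e 4) (e 5) 0 (e 4))"
  "N1_2_09 \<alpha> = table_alg (2 + 3) (normal_table (e 4) (\<alpha> *\<^sub>C e 5) (e 5) (e 4))"
  "N1_3_01 = table_alg (3 + 3) (normal_table (e 4) (e 5) (e 6) 0)"
  "N1_3_02 = table_alg (3 + 3) (normal_table (e 4) (e 5) 0 (e 6))"
  "N1_3_03 \<alpha> = table_alg (3 + 3) (normal_table (e 4) (\<alpha> *\<^sub>C e 5) (e 5) (e 6))"
  "N1_3_04 = table_alg (3 + 3) (normal_table (e 4) (e 5) (e 5 + e 6) (e 6))"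
  "N1_3_05 = table_alg (3 + 3) (normal_table (e 4) (e 5) (e 4 + 2 *\<^sub>C e 5) (e 6))"
  "N1_3_06 = table_alg (3 + 3) (normal_table (e 4) (e 5) (e 6) (e 4))"
  "N1_4_01 = table_alg (4 + 3) (normal_table (e 4) (e 5) (e 6) (e 7))"
  unfolding N1_1_01_def N1_1_02_def N1_2_01_def N1_2_02_def N1_2_03_def N1_2_04_def N1_2_05_def
    N1_2_06_def N1_2_07_def N1_2_08_def N1_2_09_def N1_3_01_def N1_3_02_def N1_3_03_def
    N1_3_04_def N1_3_05_def N1_3_06_def N1_4_01_def normal_table_def
  by (simp_all, (rule table_alg_cong, simp add: table_entry_def)+)

lemma combination_explicit:
  "combination [v1] w = w 4 *\<^sub>C v1"
  "combination [v1, v2] w = w 4 *\<^sub>C v1 + w 5 *\<^sub>C v2"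
  "combination [v1, v2, v3] w = w 4 *\<^sub>C v1 + w 5 *\<^sub>C v2 + w 6 *\<^sub>C v3"
  "combination [v1, v2, v3, v4] w = w 4 *\<^sub>C v1 + w 5 *\<^sub>C v2 + w 6 *\<^sub>C v3 + w 7 *\<^sub>C v4"
  by (simp_all add: combination_def)

lemmas normal_form_simps = listed_algebras_normal combination_explicit scaleC_apply
  e_apply scaleC_one cvs.subspace_0[OF subspace_supported] cvs.subspace_add[OF subspace_supported]
  cvs.subspace_scale[OF subspace_supported] e_in_supported

section \<open>Normal forms of structure vectors\<close>

definition listed :: "nat \<Rightarrow> 'a::complex_vector alg \<Rightarrow> bool" where
  "listed i B \<longleftrightarrow>
     i = 1 \<and> (B \<cong>\<^sub>a N1_1_01 \<or> B \<cong>\<^sub>a N1_1_02) \<or>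
     i = 2 \<and> (B \<cong>\<^sub>a N1_2_01 \<or> (\<exists>\<alpha>. B \<cong>\<^sub>a N1_2_02 \<alpha>) \<or> B \<cong>\<^sub>a N1_2_03 \<or> B \<cong>\<^sub>a N1_2_04 \<or>
              B \<cong>\<^sub>a N1_2_05 \<or> B \<cong>\<^sub>a N1_2_06 \<or> B \<cong>\<^sub>a N1_2_07 \<or> B \<cong>\<^sub>a N1_2_08 \<or>
              (\<exists>\<alpha>. B \<cong>\<^sub>a N1_2_09 \<alpha>)) \<or>
     i = 3 \<and> (B \<cong>\<^sub>a N1_3_01 \<or> B \<cong>\<^sub>a N1_3_02 \<or> (\<exists>\<alpha>. B \<cong>\<^sub>a N1_3_03 \<alpha>) \<or> B \<cong>\<^sub>a N1_3_04 \<or>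
              B \<cong>\<^sub>a N1_3_05 \<or> B \<cong>\<^sub>a N1_3_06) \<or>
     i = 4 \<and> B \<cong>\<^sub>a N1_4_01"

lemma dim_independent:
  assumes "cvs.independent S" "finite S" "cvs.span S = V"
  shows "cvs.dim V = card S"
  using assms cvs.dim_span_eq_card_independent by blast

lemma independent_insert_card:
  assumes "cvs.independent S" "finite S" "v \<notin> cvs.span S"
  shows "cvs.independent (insert v S)" "card (insert v S) = Suc (card S)"
proof -
  have "v \<notin> S" using assms(3) cvs.span_base by blast
  then show "cvs.independent (insert v S)" "card (insert v S) = Suc (card S)"
    using assms by (simp_all add: cvs.independent_insert)
qed

lemma independent1: "a \<noteq> 0 \<Longrightarrow> cvs.independent {a} \<and> card {a} = 1"
  by simp

lemma independent2:
  assumes "a \<noteq> 0" "d \<notin> cvs.span {a}"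
  shows "cvs.independent {d, a} \<and> card {d, a} = 2"
  using independent_insert_card[of "{a}" d] assms by simp

lemma independent3:
  assumes "a \<noteq> 0" "d \<notin> cvs.span {a}" "c \<notin> cvs.span {d, a}"
  shows "cvs.independent {c, d, a} \<and> card {c, d, a} = 3"
  using independent_insert_card[of "{d, a}" c] independent2[OF assms(1,2)] assms by simp

lemma independent4:
  assumes "a \<noteq> 0" "d \<notin> cvs.span {a}" "c \<notin> cvs.span {d, a}" "b \<notin> cvs.span {c, d, a}"
  shows "cvs.independent {b, c, d, a} \<and> card {b, c, d, a} = 4"
  using independent_insert_card[of "{c, d, a}" b] independent3[OF assms(1-3)] assms by simp

text \<open>Here \<open>a\<close> and \<open>d\<close> stay independent under all changes of basis. If \<open>c\<close> is independent of them, only the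
  relation expressing \<open>b\<close> matters, with its exceptional values \<open>\<alpha> = 1/2\<close> and \<open>\<alpha> = 1\<close>. Otherwise
  \<open>s\<close> and \<open>u\<close> are spent on achieving \<open>c = 0\<close>, and the scalings reduce the coefficients of
  \<open>b = \<beta> a + \<delta> d\<close> to \<open>0\<close> or \<open>1\<close>.\<close>
lemma classification_d_independent:
  assumes Z2: "\<theta> \<in> Z2 N1 V" and S: "structure_vectors V \<theta> a b c d" and d: "d \<notin> cvs.span {a}"
  shows "listed (cvs.dim V) (central_ext N1 V \<theta>)" (is "listed _ ?B")
proof -
  have a: "a \<noteq> 0" and V: "cvs.span {a, b, c, d} = V" using S by (simp_all add: structure_vectors_def)
  note iso = central_ext_iso_table[OF Z2]
  show ?thesis
  proof (cases "c \<in> cvs.span {d, a}")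
    case False
    show ?thesis
    proof (cases "b \<in> cvs.span {c, d, a}")
      case b: False
      have dim: "cvs.dim V = 4"
        using dim_independent[of "{b, c, d, a}" V] independent4[OF a d False b] V
        by (simp add: insert_commute)
      have "?B \<cong>\<^sub>a N1_4_01"
        using iso[OF S, of "[a, b, c, d]" "e 4" "e 5" "e 6" "e 7"] dim by (simp add: normal_form_simps)
      then show ?thesis by (simp add: listed_def dim)
    next
      case True
      have "cvs.span {c, d, a} = V"
        using cvs.span_redundant[OF True] V by (simp add: insert_commute)
      then have dim: "cvs.dim V = 3"
        using dim_independent[of "{c, d, a}" V] independent3[OF a d False] by simp
      obtain \<alpha> \<beta> \<delta> where "b = \<alpha> *\<^sub>C c + \<beta> *\<^sub>C a + \<delta> *\<^sub>C d" using in_span3[OF True] by blast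
      then obtain b' c' \<beta>' \<delta>' where S': "structure_vectors V \<theta> a b' c' d"
        and b': "b' = \<alpha> *\<^sub>C c' + \<beta>' *\<^sub>C a + \<delta>' *\<^sub>C d"
        and kill: "\<alpha> \<noteq> 1 / 2 \<Longrightarrow> \<beta>' = 0" "\<alpha> \<noteq> 1 \<Longrightarrow> \<delta>' = 0"
        using structure_vectors_reduce_relation[OF Z2 S] by metis
      consider "\<beta>' = 0" "\<delta>' = 0" | "\<alpha> = 1 / 2" "\<beta>' \<noteq> 0" "\<delta>' = 0" | "\<alpha> = 1" "\<beta>' = 0" "\<delta>' \<noteq> 0"
        using kill by fastforce
      then show ?thesis
      proof cases
        case 1
        have "?B \<cong>\<^sub>a N1_3_03 \<alpha>"
          using iso[OF S', of "[a, c', d]" "e 4" "\<alpha> *\<^sub>C e 5" "e 5" "e 6"] dim 1 b' by (simp add: normal_form_simps)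
        then show ?thesis by (auto simp: listed_def dim)
      next
        case 2
        define w where "w = - 1 / (2 * \<beta>')"
        have w: "w \<noteq> 0" using 2 by (simp add: w_def)
        have c': "w *\<^sub>C c' = a + (2 * w) *\<^sub>C b'"
          using half_relation[of b' c' \<beta>' a w] b' 2 w_def by simp
        have "?B \<cong>\<^sub>a N1_3_05"
          using iso[OF structure_vectors_scale[OF Z2 S' _ w, of 1], of "[a, w *\<^sub>C b', w\<^sup>2 *\<^sub>C d]" "e 4" "e 5" "e 4 + 2 *\<^sub>C e 5" "e 6"] dim c'
          by (simp add: normal_form_simps)
        then show ?thesis by (auto simp: listed_def dim)
      next
        case 3
        \<comment> \<open>the scaling that turns \<open>b = c + \<delta>' d\<close> into \<open>c = b + d\<close>\<close>
        define w where "w = - \<delta>'"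
        have w: "w \<noteq> 0" using 3 by (simp add: w_def)
        have c': "w *\<^sub>C c' = w *\<^sub>C b' + w\<^sup>2 *\<^sub>C d"
          using 3 by (simp add: b' w_def scaleC_add_right scaleC_scaleC scaleC_one power2_eq_square)
        have "?B \<cong>\<^sub>a N1_3_04"
          using iso[OF structure_vectors_scale[OF Z2 S' _ w, of 1], of "[a, w *\<^sub>C b', w\<^sup>2 *\<^sub>C d]" "e 4" "e 5" "e 5 + e 6" "e 6"] dim c'
          by (simp add: normal_form_simps)
        then show ?thesis by (auto simp: listed_def dim)
      qed
    qed
  next
    case True
    then obtain b' where S': "structure_vectors V \<theta> a b' 0 d" using structure_vectors_eliminate_c[OF Z2 S] by blast
    then have V': "cvs.span {a, b', 0, d} = V" by (simp add: structure_vectors_def)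
    show ?thesis
    proof (cases "b' \<in> cvs.span {d, a}")
      case False
      have dim: "cvs.dim V = 3"
        using dim_independent[of "{b', d, a}" V] independent3[OF a d False] V' cvs.span_insert_0[of "{b', d, a}"]
        by (simp add: insert_commute)
      have "?B \<cong>\<^sub>a N1_3_02"
        using iso[OF S', of "[a, b', d]" "e 4" "e 5" 0 "e 6"] dim by (simp add: normal_form_simps)
      then show ?thesis by (simp add: listed_def dim)
    next
      case True
      have "cvs.span {d, a} = V"
        using cvs.span_redundant[OF True] V' cvs.span_insert_0[of "{b', d, a}"] by (simp add: insert_commute)
      then have dim: "cvs.dim V = 2"
        using dim_independent[of "{d, a}" V] independent2[OF a d] by simp
      obtain \<beta> \<delta> where b': "b' = \<beta> *\<^sub>C a + \<delta> *\<^sub>C d" using in_span2[OF True] by blast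
      consider "\<beta> = 0" "\<delta> = 0" | "\<beta> = 0" "\<delta> \<noteq> 0" | "\<beta> \<noteq> 0" "\<delta> = 0" | "\<beta> \<noteq> 0" "\<delta> \<noteq> 0" by blast
      then show ?thesis
      proof cases
        case 1
        have "?B \<cong>\<^sub>a N1_2_04"
          using iso[OF S', of "[a, d]" "e 4" 0 0 "e 5"] dim 1 b' by (simp add: normal_form_simps)
        then show ?thesis by (simp add: listed_def dim)
      next
        case 2
        have b'': "\<delta> *\<^sub>C b' = \<delta>\<^sup>2 *\<^sub>C d" using 2 b' by (simp add: scaleC_scaleC power2_eq_square)
        have "?B \<cong>\<^sub>a N1_2_03"
          using iso[OF structure_vectors_scale[OF Z2 S', of 1 \<delta>], of "[a, \<delta>\<^sup>2 *\<^sub>C d]" "e 4" "e 5" 0 "e 5"] dim 2 b''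
          by (simp add: normal_form_simps)
        then show ?thesis by (simp add: listed_def dim)
      next
        case 3
        have b'': "(1 / \<beta>) *\<^sub>C b' = a" using 3 b' by (simp add: scaleC_scaleC scaleC_one)
        have "?B \<cong>\<^sub>a N1_2_05"
          using iso[OF structure_vectors_scale[OF Z2 S', of 1 "1 / \<beta>"], of "[a, (1 / \<beta>)\<^sup>2 *\<^sub>C d]" "e 4" "e 4" 0 "e 5"] dim 3 b''
          by (simp add: normal_form_simps)
        then show ?thesis by (simp add: listed_def dim)
      next
        case 4
        \<comment> \<open>the solution of \<open>x w \<beta> = x\<^sup>3\<close> and \<open>x w \<delta> = w\<^sup>2\<close>, which makes \<open>b = a + d\<close>\<close>
        define x where "x = \<delta> * \<beta>"
        define w where "w = \<delta>\<^sup>2 * \<beta>"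
        have xw: "x \<noteq> 0" "w \<noteq> 0" using 4 by (simp_all add: x_def w_def)
        have "x * w * \<beta> = x ^ 3" "x * w * \<delta> = w\<^sup>2"
          by (simp_all add: x_def w_def power2_eq_square power3_eq_cube)
        then have b'': "(x * w) *\<^sub>C b' = (x ^ 3) *\<^sub>C a + w\<^sup>2 *\<^sub>C d"
          by (simp add: b' scaleC_add_right scaleC_scaleC)
        have "?B \<cong>\<^sub>a N1_2_06"
          using iso[OF structure_vectors_scale[OF Z2 S' xw], of "[(x ^ 3) *\<^sub>C a, w\<^sup>2 *\<^sub>C d]" "e 4" "e 4 + e 5" 0 "e 5"] dim b''
          by (simp add: normal_form_simps)
        then show ?thesis by (simp add: listed_def dim)
      qed
    qed
  qed
qed

text \<open>Now \<open>s\<close> and \<open>u\<close> both add multiples of \<open>a\<close>, to \<open>(b, c)\<close> in the independent proportions \<open>1 : 2\<close> and \<open>1 : 1\<close>.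
  So the multiples of \<open>a\<close> in \<open>b\<close> and \<open>c\<close> can always be removed, and no value of \<open>\<alpha>\<close> is exceptional.\<close>
lemma classification_d_eq_a:
  assumes Z2: "\<theta> \<in> Z2 N1 V" and S: "structure_vectors V \<theta> a b c a"
  shows "listed (cvs.dim V) (central_ext N1 V \<theta>)" (is "listed _ ?B")
proof -
  have a: "a \<noteq> 0" and V: "cvs.span {a, b, c} = V" using S by (simp_all add: structure_vectors_def insert_commute)
  note iso = central_ext_iso_table[OF Z2]
  show ?thesis
  proof (cases "c \<in> cvs.span {a}")
    case False
    show ?thesis
    proof (cases "b \<in> cvs.span {c, a}")
      case b: False
      have dim: "cvs.dim V = 3"
        using dim_independent[of "{b, c, a}" V] independent3[OF a False b] V by (simp add: insert_commute)
      have "?B \<cong>\<^sub>a N1_3_06"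
        using iso[OF S, of "[a, b, c]" "e 4" "e 5" "e 6" "e 4"] dim by (simp add: normal_form_simps)
      then show ?thesis by (simp add: listed_def dim)
    next
      case True
      have "cvs.span {c, a} = V" using cvs.span_redundant[OF True] V by (simp add: insert_commute)
      then have dim: "cvs.dim V = 2" using dim_independent[of "{c, a}" V] independent2[OF a False] by simp
      obtain \<alpha> \<beta> where b: "b = \<alpha> *\<^sub>C c + \<beta> *\<^sub>C a" using in_span2[OF True] by (metis add.commute)
      obtain b' c' where S': "structure_vectors V \<theta> a b' c' a" and b': "b' = \<alpha> *\<^sub>C c'"
      \<comment> \<open>since \<open>d = a\<close>, the term \<open>\<beta> a\<close> may be counted as \<open>\<delta> d\<close>, which is removable for \<open>\<alpha> = 1/2\<close>\<close>
      proof (cases "\<alpha> = 1 / 2")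
        case True
        have half: "(1 / 2 :: complex) \<noteq> 1" by simp
        have "b = \<alpha> *\<^sub>C c + 0 *\<^sub>C a + \<beta> *\<^sub>C a" using b by simp
        then obtain b' c' \<beta>' \<delta>' where *: "structure_vectors V \<theta> a b' c' a"
          "b' = \<alpha> *\<^sub>C c' + \<beta>' *\<^sub>C a + \<delta>' *\<^sub>C a" "\<beta>' = 0" "\<delta>' = 0"
          using structure_vectors_reduce_relation[OF Z2 S] True half by metis
        show thesis by (rule that[OF *(1)]) (simp only: *, simp)
      next
        case False
        have "b = \<alpha> *\<^sub>C c + \<beta> *\<^sub>C a + 0 *\<^sub>C a" using b by simp
        then obtain b' c' \<beta>' \<delta>' where *: "structure_vectors V \<theta> a b' c' a"
          "b' = \<alpha> *\<^sub>C c' + \<beta>' *\<^sub>C a + \<delta>' *\<^sub>C a" "\<beta>' = 0" "\<delta>' = 0"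
          using structure_vectors_reduce_relation[OF Z2 S] False by metis
        show thesis by (rule that[OF *(1)]) (simp only: *, simp)
      qed
      have "?B \<cong>\<^sub>a N1_2_09 \<alpha>"
        using iso[OF S', of "[a, c']" "e 4" "\<alpha> *\<^sub>C e 5" "e 5" "e 4"] dim b' by (simp add: normal_form_simps)
      then show ?thesis by (auto simp: listed_def dim)
    qed
  next
    case True
    then obtain b' where S': "structure_vectors V \<theta> a b' 0 a" using structure_vectors_eliminate_c[OF Z2 S] by auto
    then have V': "cvs.span {b', a} = V"
      using cvs.span_insert_0[of "{b', a}"] by (simp add: structure_vectors_def insert_commute)
    show ?thesis
    proof (cases "b' \<in> cvs.span {a}")
      case False
      have dim: "cvs.dim V = 2" using dim_independent[of "{b', a}" V] independent2[OF a False] V' by simp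
      have "?B \<cong>\<^sub>a N1_2_08"
        using iso[OF S', of "[a, b']" "e 4" "e 5" 0 "e 4"] dim by (simp add: normal_form_simps)
      then show ?thesis by (simp add: listed_def dim)
    next
      case True
      have "cvs.span {a} = V" using cvs.span_redundant[OF True] V' by simp
      then have dim: "cvs.dim V = 1" using dim_independent[of "{a}" V] independent1[OF a] by simp
      obtain \<beta> where b': "b' = \<beta> *\<^sub>C a" using in_span1[OF True] by blast
      \<comment> \<open>with \<open>u = - 2 s\<close> the shift leaves \<open>c = 0\<close> unchanged and adds \<open>- s a\<close> to \<open>b\<close>\<close>
      have "b' + \<beta> *\<^sub>C a + (- 2 * \<beta>) *\<^sub>C a = 0"
        unfolding b' scaleC_add_left[symmetric] by simp
      then have "structure_vectors V \<theta> a 0 0 a"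
        using structure_vectors_shift[OF Z2 S', of \<beta> "- 2 * \<beta>"] by simp
      from iso[OF this, of "[a]" "e 4" 0 0 "e 4"] dim have "?B \<cong>\<^sub>a N1_1_01" by (simp add: normal_form_simps)
      then show ?thesis by (simp add: listed_def dim)
    qed
  qed
qed

text \<open>Only the shift by \<open>s\<close> is left, so \<open>\<alpha> = 1/2\<close> is exceptional.\<close>
lemma classification_d_zero:
  assumes Z2: "\<theta> \<in> Z2 N1 V" and S: "structure_vectors V \<theta> a b c 0"
    and nz: "\<not> structure_vectors V \<theta> a 0 0 0"
  shows "listed (cvs.dim V) (central_ext N1 V \<theta>)" (is "listed _ ?B")
proof -
  have a: "a \<noteq> 0" and V: "cvs.span {a, b, c} = V"
    using S cvs.span_insert_0[of "{a, b, c}"] by (simp_all add: structure_vectors_def insert_commute)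
  note iso = central_ext_iso_table[OF Z2]
  show ?thesis
  proof (cases "c \<in> cvs.span {a}")
    case False
    show ?thesis
    proof (cases "b \<in> cvs.span {c, a}")
      case b: False
      have dim: "cvs.dim V = 3"
        using dim_independent[of "{b, c, a}" V] independent3[OF a False b] V by (simp add: insert_commute)
      have "?B \<cong>\<^sub>a N1_3_01"
        using iso[OF S, of "[a, b, c]" "e 4" "e 5" "e 6" 0] dim by (simp add: normal_form_simps)
      then show ?thesis by (simp add: listed_def dim)
    next
      case True
      have "cvs.span {c, a} = V" using cvs.span_redundant[OF True] V by (simp add: insert_commute)
      then have dim: "cvs.dim V = 2" using dim_independent[of "{c, a}" V] independent2[OF a False] by simp
      obtain \<alpha> \<beta> where "b = \<alpha> *\<^sub>C c + \<beta> *\<^sub>C a" using in_span2[OF True] by (metis add.commute)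
      then have "b = \<alpha> *\<^sub>C c + \<beta> *\<^sub>C a + 0 *\<^sub>C 0" by simp
      then obtain b' c' \<beta>' where S': "structure_vectors V \<theta> a b' c' 0" and b': "b' = \<alpha> *\<^sub>C c' + \<beta>' *\<^sub>C a"
        and kill: "\<alpha> \<noteq> 1 / 2 \<Longrightarrow> \<beta>' = 0"
        using structure_vectors_reduce_relation[OF Z2 S] by (metis add.right_neutral cvs.scale_zero_right)
      show ?thesis
      proof (cases "\<beta>' = 0")
        case True
        have "?B \<cong>\<^sub>a N1_2_02 \<alpha>"
          using iso[OF S', of "[a, c']" "e 4" "\<alpha> *\<^sub>C e 5" "e 5" 0] dim b' True by (simp add: normal_form_simps)
        then show ?thesis by (auto simp: listed_def dim)
      next
        case False
        define w where "w = - 1 / (2 * \<beta>')"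
        have w: "w \<noteq> 0" using False by (simp add: w_def)
        have "\<alpha> = 1 / 2" using kill False by blast
        then have c': "w *\<^sub>C c' = a + (2 * w) *\<^sub>C b'"
          using half_relation[of b' c' \<beta>' a w] b' False w_def by simp
        have "?B \<cong>\<^sub>a N1_2_07"
          using iso[OF structure_vectors_scale[OF Z2 S' _ w, of 1], of "[a, w *\<^sub>C b']" "e 4" "e 5" "e 4 + 2 *\<^sub>C e 5" 0] dim c'
          by (simp add: normal_form_simps)
        then show ?thesis by (simp add: listed_def dim)
      qed
    qed
  next
    case True
    then have "c \<in> cvs.span {0, a}" using cvs.span_insert_0[of "{a}"] by simp
    then obtain b' where S': "structure_vectors V \<theta> a b' 0 0" using structure_vectors_eliminate_c[OF Z2 S] by blast
    then have V': "cvs.span {b', a} = V"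
      using cvs.span_insert_0[of "{b', a}"] by (simp add: structure_vectors_def insert_commute)
    show ?thesis
    proof (cases "b' \<in> cvs.span {a}")
      case False
      have dim: "cvs.dim V = 2" using dim_independent[of "{b', a}" V] independent2[OF a False] V' by simp
      have "?B \<cong>\<^sub>a N1_2_01"
        using iso[OF S', of "[a, b']" "e 4" "e 5" 0 0] dim by (simp add: normal_form_simps)
      then show ?thesis by (simp add: listed_def dim)
    next
      case True
      have "cvs.span {a} = V" using cvs.span_redundant[OF True] V' by simp
      then have dim: "cvs.dim V = 1" using dim_independent[of "{a}" V] independent1[OF a] by simp
      obtain \<beta> where b': "b' = \<beta> *\<^sub>C a" using in_span1[OF True] by blast
      have \<beta>: "\<beta> \<noteq> 0" using nz S' b' by auto
      have b'': "(1 / \<beta>) *\<^sub>C b' = a" using \<beta> b' by (simp add: scaleC_scaleC scaleC_one)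
      have "?B \<cong>\<^sub>a N1_1_02"
        using iso[OF structure_vectors_scale[OF Z2 S', of 1 "1 / \<beta>"], of "[a]" "e 4" "e 4" 0 0] dim \<beta> b''
        by (simp add: normal_form_simps)
      then show ?thesis by (simp add: listed_def dim)
    qed
  qed
qed

theorem theorem6:
  fixes V :: "'v::complex_vector set"
    and \<theta> :: "(nat \<Rightarrow> complex) \<Rightarrow> (nat \<Rightarrow> complex) \<Rightarrow> 'v"
    and i :: nat
  assumes "fd_space V" and "cvs.dim V = i" and "i \<ge> 1"
    and "\<theta> \<in> Z2 N1 V"
    and "nontrivial_ext N1 V \<theta>"
  defines "B \<equiv> central_ext N1 V \<theta>"
  shows
    "i = 1 \<and> (B \<cong>\<^sub>a N1_1_01 \<or> B \<cong>\<^sub>a N1_1_02) \<or>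
     i = 2 \<and> (B \<cong>\<^sub>a N1_2_01 \<or> (\<exists>\<alpha>. B \<cong>\<^sub>a N1_2_02 \<alpha>) \<or> B \<cong>\<^sub>a N1_2_03 \<or> B \<cong>\<^sub>a N1_2_04 \<or>
              B \<cong>\<^sub>a N1_2_05 \<or> B \<cong>\<^sub>a N1_2_06 \<or> B \<cong>\<^sub>a N1_2_07 \<or> B \<cong>\<^sub>a N1_2_08 \<or>
              (\<exists>\<alpha>. B \<cong>\<^sub>a N1_2_09 \<alpha>)) \<or>
     i = 3 \<and> (B \<cong>\<^sub>a N1_3_01 \<or> B \<cong>\<^sub>a N1_3_02 \<or> (\<exists>\<alpha>. B \<cong>\<^sub>a N1_3_03 \<alpha>) \<or> B \<cong>\<^sub>a N1_3_04 \<or>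
              B \<cong>\<^sub>a N1_3_05 \<or> B \<cong>\<^sub>a N1_3_06) \<or>
     i = 4 \<and> B \<cong>\<^sub>a N1_4_01"
proof -
  have V: "cvs.subspace V" using assms(1) by (rule fd_space_subspace)
  have ns: "non_split (central_ext N1 V \<theta>)" using assms(5) by (simp add: nontrivial_ext_def)
  let ?a = "\<theta> (e 1) (e 2)" and ?b = "\<theta> (e 1) (e 3)" and ?c = "\<theta> (e 3) (e 1)" and ?d = "\<theta> (e 3) (e 3)"
  have "mul N1 (e 1) (e 1) = e 2" by (simp add: mul_N1 e_apply scaleC_one)
  then have S: "structure_vectors V \<theta> ?a ?b ?c ?d"
    using nontrivial_ext_imp_nonzero[OF assms(1,4,5)] non_split_span[OF assms(4) V ns] adapted_e
    unfolding structure_vectors_def by metis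
  note nz = non_split_not_all_zero[OF assms(4) V ns]
  have "listed (cvs.dim V) (central_ext N1 V \<theta>)"
  proof (cases "?d \<in> cvs.span {?a}")
    case False
    then show ?thesis by (rule classification_d_independent[OF assms(4) S])
  next
    case True
    then obtain k where k: "?d = k *\<^sub>C ?a" using in_span1 by blast
    show ?thesis
    proof (cases "k = 0")
      case True
      then show ?thesis using classification_d_zero[OF assms(4) _ nz] S k by simp
    next
      case False
      obtain b c where "structure_vectors V \<theta> ?a b c ?a"
        using structure_vectors_normalize_d[OF assms(4) S[unfolded k] False] by blast
      then show ?thesis by (rule classification_d_eq_a[OF assms(4)])
    qed
  qed
  then show ?thesis unfolding listed_def assms(2) B_def .
qed

end
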